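(* Let $p$ be an odd prime and let $A$ be any finite $p$-group acting $\mathbf F_2$-linearly on $V=\mathbf F_2^n$ with $C_V(A)=0$. Then $(A,V)$ is not balanced, i.e. $V$ has no $A$-stable subset of size $|V|/2$. In particular, for every such $(A,V)$, the coprime action of $A$ on $G=B\rtimes V$ is not a counterexample to the equality $|N_A(G)|=|C_G(A)/C_G(A)'|$.
   Context: $C_V(A)$ is the subspace of vectors fixed by all of $A$. $B$ is the additive group of all functions $V\to\mathbf F_2$; $(\tau_tf)(x)=f(x+t)$; $G=B\rtimes V$ has multiplication $(f,t)(g,s)=(f+\tau_tg,\,t+s)$; $A$ acts on $G$ by $a\cdot(f,t)=(f\circ a^{-1},a\cdot t)$. $C_G(A)$ is the subgroup of $A$-fixed elements of $G$, $C_G(A)'$ its derived subgroup, $\operatorname{Irr}_A(G)$ the set of $A$-invariant irreducible complex characters of $G$, and $N_A(G)=\{\chi\in\operatorname{Irr}_A(G):\chi(c)\ne0\ \forall c\in C_G(A)\}$. *)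

theory Defs
  imports
    "HOL-Algebra.Generated_Groups"
    "HOL-Algebra.Group_Action"
    "HOL-Library.Z2"
    "HOL-Library.FuncSet"
    "Jordan_Normal_Form.VS_Connect"
begin

text \<open>The field \<open>\<bbbF>\<^sub>2\<close> is the type \<^typ>\<open>bit\<close>, and \<open>V = \<bbbF>\<^sub>2\<^sup>n\<close> is the carrier set
  \<open>carrier_vec n :: bit vec set\<close>.\<close>

subsection \<open>Actions\<close>

definition linear_action :: "('a, 'c) monoid_scheme \<Rightarrow> nat \<Rightarrow> ('a \<Rightarrow> bit vec \<Rightarrow> bit vec) \<Rightarrow> bool" where
  "linear_action A n \<phi> \<longleftrightarrow>
     group_action A (carrier_vec n) \<phi> \<and>
     (\<forall>a \<in> carrier A.
        (\<forall>v \<in> carrier_vec n. \<forall>w \<in> carrier_vec n. \<phi> a (v + w) = \<phi> a v + \<phi> a w) \<and>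
        (\<forall>c. \<forall>v \<in> carrier_vec n. \<phi> a (c \<cdot>\<^sub>v v) = c \<cdot>\<^sub>v \<phi> a v))"

text \<open>\<open>fixed_points A act \<Omega>\<close> is \<open>C\<^sub>\<Omega>(A)\<close>.\<close>

definition fixed_points :: "('a, 'c) monoid_scheme \<Rightarrow> ('a \<Rightarrow> 'x \<Rightarrow> 'x) \<Rightarrow> 'x set \<Rightarrow> 'x set" where
  "fixed_points A act \<Omega> = {x \<in> \<Omega>. \<forall>a \<in> carrier A. act a x = x}"

definition balanced :: "('a, 'c) monoid_scheme \<Rightarrow> nat \<Rightarrow> ('a \<Rightarrow> bit vec \<Rightarrow> bit vec) \<Rightarrow> bool" where
  "balanced A n \<phi> \<longleftrightarrow>
     (\<exists>S \<subseteq> carrier_vec n. (\<forall>a \<in> carrier A. \<phi> a ` S \<subseteq> S) \<and>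
        2 * card S = card (carrier_vec n :: bit vec set))"

subsection \<open>The group \<open>G = B \<rtimes> V\<close> and the action of \<open>A\<close> on it\<close>

text \<open>Functions \<open>V \<rightarrow> \<bbbF>\<^sub>2\<close> are represented extensionally, i.e. they are \<^const>\<open>undefined\<close>
  outside \<open>V\<close>, so that each of them has exactly one representative.\<close>

definition funs :: "nat \<Rightarrow> (bit vec \<Rightarrow> bit) set" where
  "funs n = carrier_vec n \<rightarrow>\<^sub>E UNIV"

definition translate :: "nat \<Rightarrow> bit vec \<Rightarrow> (bit vec \<Rightarrow> bit) \<Rightarrow> (bit vec \<Rightarrow> bit)" where
  "translate n t f = (\<lambda>x \<in> carrier_vec n. f (x + t))"

definition semidirect :: "nat \<Rightarrow> ((bit vec \<Rightarrow> bit) \<times> bit vec) monoid" where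
  "semidirect n =
     \<lparr>carrier = funs n \<times> carrier_vec n,
      mult = (\<lambda>(f, t) (g, s). (\<lambda>x \<in> carrier_vec n. f x + translate n t g x, t + s)),
      one = (\<lambda>x \<in> carrier_vec n. 0, 0\<^sub>v n)\<rparr>"

definition semidirect_action ::
  "('a, 'c) monoid_scheme \<Rightarrow> nat \<Rightarrow> ('a \<Rightarrow> bit vec \<Rightarrow> bit vec)
     \<Rightarrow> 'a \<Rightarrow> (bit vec \<Rightarrow> bit) \<times> bit vec \<Rightarrow> (bit vec \<Rightarrow> bit) \<times> bit vec" where
  "semidirect_action A n \<phi> a =
     (\<lambda>(f, t) \<in> carrier (semidirect n).
        (\<lambda>x \<in> carrier_vec n. f (\<phi> (inv\<^bsub>A\<^esub> a) x), \<phi> a t))"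

subsection \<open>Irreducible complex characters\<close>

text \<open>The group of units of \<^term>\<open>ring_mat TYPE(complex) d ()\<close> is \<open>GL\<^sub>d(\<complex>)\<close>.\<close>

definition representation :: "('g, 'c) monoid_scheme \<Rightarrow> nat \<Rightarrow> ('g \<Rightarrow> complex mat) \<Rightarrow> bool" where
  "representation G d \<rho> \<longleftrightarrow> \<rho> \<in> hom G (units_of (ring_mat TYPE(complex) d ()))"

definition irreducible_representation ::
  "('g, 'c) monoid_scheme \<Rightarrow> nat \<Rightarrow> ('g \<Rightarrow> complex mat) \<Rightarrow> bool" where
  "irreducible_representation G d \<rho> \<longleftrightarrow>
     representation G d \<rho> \<and> d > 0 \<and>
     (\<forall>W. VectorSpace.subspace class_ring W (module_vec TYPE(complex) d) \<and>
          (\<forall>g \<in> carrier G. \<forall>w \<in> W. \<rho> g *\<^sub>v w \<in> W)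
          \<longrightarrow> W = {0\<^sub>v d} \<or> W = carrier_vec d)"

definition mat_trace :: "complex mat \<Rightarrow> complex" where
  "mat_trace M = (\<Sum>i < dim_row M. M $$ (i, i))"

text \<open>Characters are extensional functions on the carrier, so that counting them as HOL functions
  counts the characters of \<open>G\<close>.\<close>

definition Irr :: "('g, 'c) monoid_scheme \<Rightarrow> ('g \<Rightarrow> complex) set" where
  "Irr G = {(\<lambda>g \<in> carrier G. mat_trace (\<rho> g)) | \<rho> d. irreducible_representation G d \<rho>}"

definition invariant_Irr ::
  "('a, 'b) monoid_scheme \<Rightarrow> ('a \<Rightarrow> 'g \<Rightarrow> 'g) \<Rightarrow> ('g, 'c) monoid_scheme \<Rightarrow> ('g \<Rightarrow> complex) set" where
  "invariant_Irr A act G =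
     {\<chi> \<in> Irr G. \<forall>a \<in> carrier A. \<forall>g \<in> carrier G. \<chi> (act a g) = \<chi> g}"

text \<open>\<open>nonvanishing_Irr A act G\<close> is \<open>N\<^sub>A(G)\<close>.\<close>

definition nonvanishing_Irr ::
  "('a, 'b) monoid_scheme \<Rightarrow> ('a \<Rightarrow> 'g \<Rightarrow> 'g) \<Rightarrow> ('g, 'c) monoid_scheme \<Rightarrow> ('g \<Rightarrow> complex) set" where
  "nonvanishing_Irr A act G =
     {\<chi> \<in> invariant_Irr A act G. \<forall>c \<in> fixed_points A act (carrier G). \<chi> c \<noteq> 0}"

definition fixed_subgroup ::
  "('a, 'b) monoid_scheme \<Rightarrow> ('a \<Rightarrow> 'g \<Rightarrow> 'g) \<Rightarrow> ('g, 'c) monoid_scheme \<Rightarrow> ('g, 'c) monoid_scheme" where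
  "fixed_subgroup A act G = G\<lparr>carrier := fixed_points A act (carrier G)\<rparr>"

definition abelianization :: "('g, 'c) monoid_scheme \<Rightarrow> 'g set monoid" where
  "abelianization H = H Mod (derived H (carrier H))"

subsection \<open>Well-definedness\<close>

lemma bit_add_self: "(x :: bit) + x = 0"
  by (cases x) auto

lemma bit_vec_add_self: "(t :: bit vec) \<in> carrier_vec n \<Longrightarrow> t + t = 0\<^sub>v n"
  by (intro eq_vecI) (auto simp: bit_add_self)

lemma group_semidirect: "group (semidirect n)"
proof (rule groupI, goal_cases)
  case (1 x y)
  then show ?case by (auto simp: semidirect_def funs_def)
next
  case 2
  then show ?case by (auto simp: semidirect_def funs_def)
next
  case (3 x y z)
  then show ?case
    by (auto simp: semidirect_def translate_def restrict_def fun_eq_iff add.assoc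
        assoc_add_vec[of _ n])
next
  case (4 x)
  then show ?case
    by (auto simp: semidirect_def funs_def translate_def restrict_def fun_eq_iff PiE_def
        extensional_def)
next
  case (5 x)
  obtain f t where x: "x = (f, t)" "f \<in> funs n" "t \<in> carrier_vec n"
    using 5 by (auto simp: semidirect_def)
  have "(translate n t f, t) \<in> carrier (semidirect n)"
    using x by (auto simp: semidirect_def funs_def translate_def)
  moreover have "(translate n t f, t) \<otimes>\<^bsub>semidirect n\<^esub> x = \<one>\<^bsub>semidirect n\<^esub>"
    using x by (auto simp: semidirect_def translate_def restrict_def fun_eq_iff bit_add_self
        bit_vec_add_self)
  ultimately show ?case by blast
qed

lemma UNIV_bit_eq: "(UNIV :: bit set) = {0, 1}"
  by (auto intro: bit.exhaust)

lemma card_carrier_vec_bit: "card (carrier_vec n :: bit vec set) = 2 ^ n"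
proof -
  have "bij_betw (\<lambda>f. vec n f) ({..<n} \<rightarrow>\<^sub>E (UNIV :: bit set)) (carrier_vec n)"
    by (rule bij_betwI[where g = "\<lambda>v. \<lambda>i\<in>{..<n}. v $ i"])
      (auto simp: fun_eq_iff PiE_def extensional_def)
  then have "card (carrier_vec n :: bit vec set) = card ({..<n} \<rightarrow>\<^sub>E (UNIV :: bit set))"
    by (simp add: bij_betw_same_card)
  then show ?thesis by (simp add: card_PiE UNIV_bit_eq numeral_2_eq_2)
qed

lemma order_semidirect: "Coset.order (semidirect n) = 2 ^ (2 ^ n + n)"
proof -
  have "finite (carrier_vec n :: bit vec set)"
    by (rule card_ge_0_finite) (simp add: card_carrier_vec_bit)
  then have "card (funs n) = 2 ^ 2 ^ n"
    by (simp add: funs_def card_PiE UNIV_bit_eq card_carrier_vec_bit numeral_2_eq_2)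
  then show ?thesis
    by (simp add: Coset.order_def semidirect_def card_cartesian_product card_carrier_vec_bit power_add)
qed

lemma coprime_order_semidirect:
  assumes "odd p" and "Coset.order A = p ^ k"
  shows "coprime (Coset.order A) (Coset.order (semidirect n))"
  using assms by (simp add: order_semidirect coprime_commute)

lemma semidirect_action_automorphisms:
  assumes "linear_action A n \<phi>"
  shows "group_hom A (AutoGroup (semidirect n)) (semidirect_action A n \<phi>)"
proof -
  interpret group_action A "carrier_vec n" \<phi>
    using assms by (simp add: linear_action_def)
  interpret A: group A
    using group_hom by (simp add: group_hom_def)
  interpret G: group "semidirect n" by (rule group_semidirect)
  let ?V = "carrier_vec n :: bit vec set" and ?G = "semidirect n"
  let ?\<psi> = "semidirect_action A n \<phi>"
  have cl: "\<phi> a v \<in> ?V" if "a \<in> carrier A" "v \<in> ?V" for a v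
    using element_image that by blast
  have add: "\<phi> a (v + w) = \<phi> a v + \<phi> a w"
    if "a \<in> carrier A" "v \<in> ?V" "w \<in> ?V" for a v w
    using assms that by (auto simp: linear_action_def)
  have comp: "\<phi> (a \<otimes>\<^bsub>A\<^esub> b) v = \<phi> a (\<phi> b v)"
    if "a \<in> carrier A" "b \<in> carrier A" "v \<in> ?V" for a b v
    using composition_rule that by blast
  have one: "\<phi> \<one>\<^bsub>A\<^esub> v = v" if "v \<in> ?V" for v
    using id_eq_one that by (metis restrict_apply')
  have inv: "\<phi> (inv\<^bsub>A\<^esub> a) (\<phi> a v) = v" if "a \<in> carrier A" "v \<in> ?V" for a v
    using that by (simp flip: comp add: one)
  have carr: "?\<psi> a x \<in> carrier ?G" if "a \<in> carrier A" "x \<in> carrier ?G" for a x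
    using that by (auto simp: semidirect_action_def semidirect_def funs_def cl)
  have comp': "?\<psi> (a \<otimes>\<^bsub>A\<^esub> b) x = ?\<psi> a (?\<psi> b x)"
    if "a \<in> carrier A" "b \<in> carrier A" "x \<in> carrier ?G" for a b x
    using that
    by (auto simp: semidirect_action_def semidirect_def funs_def cl comp A.inv_mult_group
        fun_eq_iff)
  have one': "?\<psi> \<one>\<^bsub>A\<^esub> x = x" if "x \<in> carrier ?G" for x
    using that by (auto simp: semidirect_action_def semidirect_def funs_def one fun_eq_iff
        PiE_def extensional_def)
  have bij: "bij_betw (?\<psi> a) (carrier ?G) (carrier ?G)" if a: "a \<in> carrier A" for a
    by (rule bij_betwI[where g = "?\<psi> (inv\<^bsub>A\<^esub> a)"])
      (use a carr in \<open>auto simp: one' simp flip: comp'\<close>)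
  have hom: "?\<psi> a \<in> hom ?G ?G" if a: "a \<in> carrier A" for a
  proof (rule homI)
    fix x y assume xy: "x \<in> carrier ?G" "y \<in> carrier ?G"
    obtain f t g s where [simp]: "x = (f, t)" "y = (g, s)" by fastforce
    have *: "f \<in> funs n" "g \<in> funs n" "t \<in> ?V" "s \<in> ?V"
      using xy by (auto simp: semidirect_def)
    have "\<phi> (inv\<^bsub>A\<^esub> a) (v + \<phi> a t) = \<phi> (inv\<^bsub>A\<^esub> a) v + t" if "v \<in> ?V" for v
      using that a * by (simp add: add cl inv)
    then show "?\<psi> a (x \<otimes>\<^bsub>?G\<^esub> y) = ?\<psi> a x \<otimes>\<^bsub>?G\<^esub> ?\<psi> a y"
      using a * by (auto simp: semidirect_action_def semidirect_def funs_def translate_def cl add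
          fun_eq_iff)
  qed (use a carr in auto)
  have ext: "?\<psi> a \<in> extensional (carrier ?G)" for a
    by (simp add: semidirect_action_def)
  have auto: "?\<psi> a \<in> auto ?G" if "a \<in> carrier A" for a
    using that bij hom ext by (auto simp: auto_def Bij_def)
  have "?\<psi> \<in> hom A (AutoGroup ?G)"
  proof (rule homI)
    fix a b assume ab: "a \<in> carrier A" "b \<in> carrier A"
    have "?\<psi> (a \<otimes>\<^bsub>A\<^esub> b) = compose (carrier ?G) (?\<psi> a) (?\<psi> b)"
      using ab ext by (intro extensionalityI[where A = "carrier ?G"])
        (auto simp: compose_def comp')
    then show "?\<psi> (a \<otimes>\<^bsub>A\<^esub> b) = ?\<psi> a \<otimes>\<^bsub>AutoGroup ?G\<^esub> ?\<psi> b"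
      using auto[OF ab(1)] auto[OF ab(2)] by (simp add: AutoGroup_def BijGroup_def auto_def)
  qed (use auto in \<open>simp add: AutoGroup_def\<close>)
  then show ?thesis
    using G.AutoGroup A.group_axioms by (auto simp: group_hom_def group_hom_axioms_def)
qed

end

theory Submission
  imports Defs
begin

text \<open>Since \<open>A\<close> is a \<open>p\<close>-group fixing only \<open>0\<close> in \<open>V\<close>, an integer-valued \<open>A\<close>-invariant function on \<open>V\<close>
  has sum congruent modulo \<open>p\<close> to its value at \<open>0\<close>. Applied to the indicators of a stable set and of \<open>V\<close>,
  this excludes \<open>2 |S| = |V|\<close>.

  By Mackey's criterion, the irreducible characters of \<open>G = B \<rtimes> V\<close> are induced from the characters
  \<open>(f, t) \<mapsto> (-1)\<^bsup>T \<bullet> f + u \<bullet> t\<^esup>\<close> of \<open>B \<rtimes> V\<^sub>T\<close>, where \<open>T \<in> B\<close> and \<open>V\<^sub>T\<close> is its stabilizer under translations.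
  If such a character is \<open>A\<close>-invariant, averaging over the odd-order group \<open>A\<close> allows one to choose \<open>T\<close>
  to be \<open>A\<close>-invariant, and then \<open>T\<close> is unique and \<open>u\<close> may be taken to be \<open>0\<close>. On \<open>C\<^sub>G(A)\<close>, which is the abelian
  group of \<open>A\<close>-invariant \<open>f\<close>, its value is a nonzero multiple of \<open>\<Sum>\<^sub>v (-1)\<^bsup>T(\<cdot> + v) \<bullet> f\<^esup>\<close>, a sum
  congruent to \<open>\<plusminus>1\<close> modulo \<open>p\<close>. So both sides of the equality count the \<open>A\<close>-invariant functions on \<open>V\<close>.\<close>

section \<open>Matrix representations\<close>

lemma subspace_module_vecI:
  assumes "W \<subseteq> carrier_vec d" and "0\<^sub>v d \<in> W"
    and "\<And>v w. v \<in> W \<Longrightarrow> w \<in> W \<Longrightarrow> v + w \<in> W"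
    and "\<And>c v. v \<in> W \<Longrightarrow> c \<cdot>\<^sub>v v \<in> W"
  shows "VectorSpace.subspace class_ring W (module_vec TYPE(complex) d)"
proof -
  interpret vec_space "TYPE(complex)" d .
  show ?thesis
    by (intro VectorSpace.subspace.intro submodule.intro vectorspace_axioms module_axioms)
      (use assms in \<open>auto simp: module_vec_simps\<close>)
qed

lemma
  assumes "VectorSpace.subspace class_ring W (module_vec TYPE(complex) d)"
  shows subspace_module_vec_add: "v \<in> W \<Longrightarrow> w \<in> W \<Longrightarrow> v + w \<in> W"
    and subspace_module_vec_smult: "v \<in> W \<Longrightarrow> c \<cdot>\<^sub>v v \<in> W"
    and subspace_module_vec_zero: "0\<^sub>v d \<in> W"
    and subspace_module_vec_carrier: "W \<subseteq> carrier_vec d"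
proof -
  interpret vec_space "TYPE(complex)" d .
  interpret VectorSpace.subspace class_ring W "module_vec TYPE(complex) d" by fact
  note * = submod[unfolded submodule_def]
  show "v \<in> W \<Longrightarrow> w \<in> W \<Longrightarrow> v + w \<in> W" "v \<in> W \<Longrightarrow> c \<cdot>\<^sub>v v \<in> W" "0\<^sub>v d \<in> W" "W \<subseteq> carrier_vec d"
    using * by (auto simp: module_vec_simps)
qed

text \<open>Linear combinations are written coordinatewise, so that twisted averages of
  matrix-vector products over a subgroup have this form directly.\<close>

lemma subspace_module_vec_sum:
  assumes W: "VectorSpace.subspace class_ring W (module_vec TYPE(complex) d)"
    and "finite S" and "\<And>s. s \<in> S \<Longrightarrow> f s \<in> W"
  shows "vec d (\<lambda>k. \<Sum>s\<in>S. c s * f s $ k) \<in> W"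
  using assms(2,3)
proof (induction S rule: finite_induct)
  case empty
  then show ?case
    using subspace_module_vec_zero[OF W] by (simp add: zero_vec_def)
next
  case (insert s S)
  have "dim_vec (f s) = d"
    using insert.prems[of s] subspace_module_vec_carrier[OF W] by auto
  then have "vec d (\<lambda>k. \<Sum>s\<in>insert s S. c s * f s $ k) = c s \<cdot>\<^sub>v f s + vec d (\<lambda>k. \<Sum>s\<in>S. c s * f s $ k)"
    using insert.hyps by (intro eq_vecI) auto
  then show ?case
    using insert by (simp add: subspace_module_vec_add[OF W] subspace_module_vec_smult[OF W])
qed

lemma mat_mult_index:
  assumes "M \<in> carrier_mat d d" "N \<in> carrier_mat d d" "i < d" "j < d"
  shows "(M * N) $$ (i, j) = (\<Sum>l<d. M $$ (i, l) * N $$ (l, j))"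
  using assms by (simp add: scalar_prod_def atLeast0LessThan)

lemma mat_mult_vec_index:
  assumes "M \<in> carrier_mat d d" "v \<in> carrier_vec d" "i < d"
  shows "(M *\<^sub>v v) $ i = (\<Sum>l<d. M $$ (i, l) * v $ l)"
  using assms by (simp add: scalar_prod_def atLeast0LessThan)

lemma mat_mult_unit_vec:
  fixes M :: "'a :: semiring_1 mat"
  assumes "M \<in> carrier_mat nr nc" "j < nc"
  shows "M *\<^sub>v unit_vec nc j = col M j"
  using assms by (intro eq_vecI) (auto simp: scalar_prod_right_unit)

text \<open>The form in which irreducibility is applied: a linear, invariant property of vectors
  that holds for one nonzero vector holds for all of them. That the zero vector has it follows by
  scaling \<open>w\<close> with 0.\<close>

lemma irreducible_representation_subspace:
  assumes "irreducible_representation G d \<rho>" and "W \<subseteq> carrier_vec d"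
    and "\<And>v w. v \<in> W \<Longrightarrow> w \<in> W \<Longrightarrow> v + w \<in> W"
    and "\<And>c v. v \<in> W \<Longrightarrow> c \<cdot>\<^sub>v v \<in> W"
    and "\<And>g v. g \<in> carrier G \<Longrightarrow> v \<in> W \<Longrightarrow> \<rho> g *\<^sub>v v \<in> W"
    and w: "w \<in> W" "w \<noteq> 0\<^sub>v d"
  shows "W = carrier_vec d"
proof -
  have "0 \<cdot>\<^sub>v w = 0\<^sub>v d" using w assms(2) by (intro eq_vecI) auto
  then have "0\<^sub>v d \<in> W" using assms(4)[OF w(1), of 0] by simp
  then have "VectorSpace.subspace class_ring W (module_vec TYPE(complex) d)"
    using assms by (intro subspace_module_vecI) auto
  then show ?thesis
    using assms unfolding irreducible_representation_def by blast
qed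

lemma mat_trace_mult_commute:
  assumes "M \<in> carrier_mat d d" "N \<in> carrier_mat d d"
  shows "mat_trace (M * N) = mat_trace (N * M)"
proof -
  have "mat_trace (M * N) = (\<Sum>i<d. \<Sum>j<d. M $$ (i,j) * N $$ (j,i))"
    using assms by (simp add: mat_trace_def scalar_prod_def atLeast0LessThan)
  also have "\<dots> = (\<Sum>j<d. \<Sum>i<d. N $$ (j,i) * M $$ (i,j))"
    by (subst sum.swap) (simp add: mult.commute)
  also have "\<dots> = mat_trace (N * M)"
    using assms by (simp add: mat_trace_def scalar_prod_def atLeast0LessThan)
  finally show ?thesis .
qed

lemma representationI:
  assumes "group G"
    and carr: "\<And>g. g \<in> carrier G \<Longrightarrow> \<rho> g \<in> carrier_mat d d"
    and mult: "\<And>g h. g \<in> carrier G \<Longrightarrow> h \<in> carrier G \<Longrightarrow> \<rho> (g \<otimes>\<^bsub>G\<^esub> h) = \<rho> g * \<rho> h"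
    and one: "\<rho> \<one>\<^bsub>G\<^esub> = 1\<^sub>m d"
  shows "representation G d \<rho>"
proof -
  interpret group G by fact
  have "\<rho> g \<in> Units (ring_mat TYPE(complex) d ())" if g: "g \<in> carrier G" for g
    using g carr[of g] carr[of "inv\<^bsub>G\<^esub> g"] mult[of g "inv\<^bsub>G\<^esub> g"] mult[of "inv\<^bsub>G\<^esub> g" g] one
    by (auto simp: Units_def ring_mat_simps intro!: bexI[of _ "\<rho> (inv\<^bsub>G\<^esub> g)"])
  then show ?thesis
    by (auto simp: representation_def hom_def units_of_def ring_mat_simps mult)
qed

lemma
  assumes "group G" and "representation G d \<rho>"
  shows representation_carrier: "g \<in> carrier G \<Longrightarrow> \<rho> g \<in> carrier_mat d d"
    and representation_mult: "g \<in> carrier G \<Longrightarrow> h \<in> carrier G \<Longrightarrow> \<rho> (g \<otimes>\<^bsub>G\<^esub> h) = \<rho> g * \<rho> h"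
    and representation_one: "\<rho> \<one>\<^bsub>G\<^esub> = 1\<^sub>m d"
proof -
  interpret R: ring "ring_mat TYPE(complex) d ()" by (rule ring_mat)
  have hom: "\<rho> \<in> hom G (units_of (ring_mat TYPE(complex) d ()))"
    using assms(2) by (simp add: representation_def)
  show "g \<in> carrier G \<Longrightarrow> \<rho> g \<in> carrier_mat d d"
    using hom_carrier[OF hom] R.Units_closed
    by (force simp: units_of_def ring_mat_simps)
  show "g \<in> carrier G \<Longrightarrow> h \<in> carrier G \<Longrightarrow> \<rho> (g \<otimes>\<^bsub>G\<^esub> h) = \<rho> g * \<rho> h"
    using hom_mult[OF hom] by (simp add: units_of_def ring_mat_simps)
  show "\<rho> \<one>\<^bsub>G\<^esub> = 1\<^sub>m d"
    using hom_one[OF hom assms(1) R.units_group] by (simp add: units_of_def ring_mat_simps)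
qed

section \<open>Monomial characters satisfying the Mackey criterion\<close>

lemma (in group) m_inv_cancel:
  assumes "x \<in> carrier G" "y \<in> carrier G"
  shows "x \<otimes> (inv x \<otimes> y) = y" and "inv x \<otimes> (x \<otimes> y) = y"
  using assms by (simp_all flip: m_assoc)

text \<open>The assumption \<open>mackey\<close> is Mackey's irreducibility criterion for a linear
  character: for g outside H, \<open>lam\<close> and its conjugate by g differ somewhere on the
  intersection of H and g H g^-1.\<close>

locale mackey_character = group G for G (structure) +
  fixes H :: "'a set" and lam :: "'a \<Rightarrow> complex"
  assumes finite_G: "finite (carrier G)"
    and subgroup_H: "subgroup H G"
    and lam_mult: "x \<in> H \<Longrightarrow> y \<in> H \<Longrightarrow> lam (x \<otimes> y) = lam x * lam y"
    and lam_one: "lam \<one> = 1"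
    and mackey: "g \<in> carrier G \<Longrightarrow> g \<notin> H \<Longrightarrow> \<exists>h\<in>H. inv g \<otimes> h \<otimes> g \<in> H \<and> lam (inv g \<otimes> h \<otimes> g) \<noteq> lam h"
begin

sublocale H: subgroup H G by (rule subgroup_H)

definition lam0 :: "'a \<Rightarrow> complex" where
  "lam0 g = (if g \<in> H then lam g else 0)"

text \<open>Frobenius' formula for the character of G induced from \<open>lam\<close>.\<close>

definition ind_char :: "'a \<Rightarrow> complex" where
  "ind_char g = (\<Sum>y\<in>carrier G. lam0 (inv y \<otimes> g \<otimes> y)) / card H"

lemma finite_H: "finite H"
  using finite_G H.subset by (rule finite_subset[rotated])

lemma card_H_nonzero: "of_nat (card H) \<noteq> (0 :: complex)"
  using finite_H H.one_closed by (auto simp del: H.one_closed)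

lemma lam_inv: "h \<in> H \<Longrightarrow> lam (inv h) * lam h = 1"
  using lam_mult[of "inv h" h] by (simp add: lam_one)

lemma sum_H_left_translate:
  assumes "k \<in> H" shows "(\<Sum>h\<in>H. F (k \<otimes> h)) = (\<Sum>h\<in>H. F h)"
  by (rule sum.reindex_bij_witness[of _ "\<lambda>h. inv k \<otimes> h" "\<lambda>h. k \<otimes> h"])
    (use assms in \<open>auto simp flip: m_assoc\<close>)

lemma sum_H_right_translate:
  assumes "k \<in> H" shows "(\<Sum>h\<in>H. F (h \<otimes> k)) = (\<Sum>h\<in>H. F h)"
  by (rule sum.reindex_bij_witness[of _ "\<lambda>h. h \<otimes> inv k" "\<lambda>h. h \<otimes> k"])
    (use assms in \<open>auto simp: m_assoc\<close>)

lemma lam0_mult_left: "h \<in> H \<Longrightarrow> g \<in> carrier G \<Longrightarrow> lam0 (h \<otimes> g) = lam h * lam0 g"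
  using H.m_closed[of "inv h" "h \<otimes> g"] by (auto simp: lam0_def lam_mult simp flip: m_assoc)

lemma lam0_mult_right: "h \<in> H \<Longrightarrow> g \<in> carrier G \<Longrightarrow> lam0 (g \<otimes> h) = lam0 g * lam h"
  using H.m_closed[of "g \<otimes> h" "inv h"] by (auto simp: lam0_def lam_mult m_assoc)

text \<open>For b in H, the factor \<open>lam h\<close> of
  \<open>lam0 (a \<otimes> h \<otimes> b)\<close> cancels against \<open>lam (inv h)\<close>, so all
  terms agree. For b outside H, substituting h k for h, with k from the Mackey condition, shows that
  the sum is multiplied by two different scalars with the same result, so it is zero.\<close>

lemma lam0_convolution:
  assumes a: "a \<in> carrier G" and b: "b \<in> carrier G"
  shows "(\<Sum>h\<in>H. lam (inv h) * lam0 (a \<otimes> h \<otimes> b)) = card H * lam0 a * lam0 b"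
proof (cases "b \<in> H")
  case True
  have "lam (inv h) * lam0 (a \<otimes> h \<otimes> b) = lam0 a * lam0 b" if h: "h \<in> H" for h
  proof -
    have "lam (inv h) * lam0 (a \<otimes> h \<otimes> b) = (lam (inv h) * lam h) * lam0 a * lam b"
      using a True h by (simp add: lam0_mult_right)
    then show ?thesis using lam_inv[OF h] True by (simp add: lam0_def)
  qed
  then show ?thesis by simp
next
  case False
  obtain k where k: "k \<in> H" "inv b \<otimes> k \<otimes> b \<in> H" "lam (inv b \<otimes> k \<otimes> b) \<noteq> lam k"
    using mackey[OF b False] by blast
  let ?S = "\<Sum>h\<in>H. lam (inv h) * lam0 (a \<otimes> h \<otimes> b)"
  have "lam k * ?S = lam k * (\<Sum>h\<in>H. lam (inv (h \<otimes> k)) * lam0 (a \<otimes> (h \<otimes> k) \<otimes> b))"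
    using sum_H_right_translate[OF k(1), of "\<lambda>h. lam (inv h) * lam0 (a \<otimes> h \<otimes> b)"] by simp
  also have "\<dots> = (\<Sum>h\<in>H. lam (inv h) * lam0 (a \<otimes> h \<otimes> b) * lam (inv b \<otimes> k \<otimes> b))"
    unfolding sum_distrib_left
  proof (rule sum.cong[OF refl])
    fix h assume h: "h \<in> H"
    have "a \<otimes> (h \<otimes> k) \<otimes> b = (a \<otimes> h \<otimes> b) \<otimes> (inv b \<otimes> k \<otimes> b)"
      using a b h k(1) by (simp add: m_assoc m_inv_cancel)
    then have "lam0 (a \<otimes> (h \<otimes> k) \<otimes> b) = lam0 (a \<otimes> h \<otimes> b) * lam (inv b \<otimes> k \<otimes> b)"
      using a b h k by (simp add: lam0_mult_right)
    moreover have "lam k * lam (inv (h \<otimes> k)) = lam (inv h)"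
      using h k(1) lam_inv[OF k(1)] by (simp add: inv_mult_group lam_mult mult.commute)
    ultimately show "lam k * (lam (inv (h \<otimes> k)) * lam0 (a \<otimes> (h \<otimes> k) \<otimes> b)) =
        lam (inv h) * lam0 (a \<otimes> h \<otimes> b) * lam (inv b \<otimes> k \<otimes> b)"
      by (metis mult.assoc)
  qed
  also have "\<dots> = lam (inv b \<otimes> k \<otimes> b) * ?S"
    by (simp add: sum_distrib_left mult_ac)
  finally have "?S = 0" using k(3) by simp
  then show ?thesis using False by (simp add: lam0_def)
qed

text \<open>The operator \<open>E\<close> is an idempotent with \<open>E \<rho>(x) E = lam0 x \<cdot> E\<close>. By irreducibility it has rank one, and
  the sum of its conjugates is the scalar \<open>card H\<close>; the trace of \<open>\<rho>(g)\<close> times this sum gives the formula.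
  Both consequences of irreducibility follow by checking that the vectors with the desired property form
  an invariant subspace containing a nonzero vector of the image of \<open>E\<close>.\<close>

theorem irreducible_trace_eq_ind_char:
  assumes irr: "irreducible_representation G d \<rho>"
    and ij0: "i0 < d" "j0 < d" "(\<Sum>h\<in>H. lam (inv h) * \<rho> h $$ (i0, j0)) \<noteq> 0"
    and g: "g \<in> carrier G"
  shows "mat_trace (\<rho> g) = ind_char g"
proof -
  have rep: "representation G d \<rho>"
    using irr by (simp add: irreducible_representation_def)
  note carr [simp] = representation_carrier[OF group_axioms rep]
  have dim [simp]: "dim_row (\<rho> x) = d" "dim_col (\<rho> x) = d" if "x \<in> carrier G" for x
    using carrier_matD[OF carr[OF that]] by auto
  note [simp] = mult_carrier_mat[of _ d d _ d] mult_mat_vec_carrier[of _ d d]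
  note [simp del] = index_mult_mat(1) index_mult_mat_vec
  note mult = representation_mult[OF group_axioms rep]
  note one = representation_one[OF group_axioms rep]
  note assoc = assoc_mult_mat[of _ d d _ d _ d]
  \<comment> \<open>The projection onto the vectors on which H acts through \<open>lam\<close>. The
    hypothesis on the entry (i0, j0) says that it is not zero.\<close>
  define E where "E = mat d d (\<lambda>(i, j). (\<Sum>h\<in>H. lam (inv h) * \<rho> h $$ (i, j)) / card H)"
  have E [simp]: "E \<in> carrier_mat d d" "dim_row E = d" "dim_col E = d" by (simp_all add: E_def)
  have E_index: "E $$ (i, j) = (\<Sum>h\<in>H. lam (inv h) * \<rho> h $$ (i, j)) / card H"
    if "i < d" "j < d" for i j using that by (simp add: E_def)
  have mult_E: "\<rho> k * E = lam k \<cdot>\<^sub>m E" if k: "k \<in> H" for k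
  proof (rule eq_matI)
    fix i j assume "i < dim_row (lam k \<cdot>\<^sub>m E)" "j < dim_col (lam k \<cdot>\<^sub>m E)"
    then have ij: "i < d" "j < d" using E by auto
    have "(\<rho> k * E) $$ (i, j) = (\<Sum>l<d. \<Sum>h\<in>H. lam (inv h) * (\<rho> k $$ (i, l) * \<rho> h $$ (l, j))) / card H"
      using ij k by (simp add: mat_mult_index[of _ d] E_index sum_distrib_left sum_divide_distrib mult_ac)
    also have "\<dots> = (\<Sum>h\<in>H. lam (inv h) * \<rho> (k \<otimes> h) $$ (i, j)) / card H"
      using ij k by (subst sum.swap) (simp add: mat_mult_index[of _ d] mult sum_distrib_left)
    also have "(\<Sum>h\<in>H. lam (inv h) * \<rho> (k \<otimes> h) $$ (i, j)) = (\<Sum>h\<in>H. lam (inv (inv k \<otimes> h)) * \<rho> h $$ (i, j))"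
      using k by (subst sum_H_left_translate[OF k, symmetric]) (auto simp: m_inv_cancel intro!: sum.cong)
    also have "\<dots> = lam k * (\<Sum>h\<in>H. lam (inv h) * \<rho> h $$ (i, j))"
      using k by (auto simp: sum_distrib_left inv_mult_group lam_mult intro!: sum.cong)
    finally show "(\<rho> k * E) $$ (i, j) = (lam k \<cdot>\<^sub>m E) $$ (i, j)"
      using ij E by (simp add: E_index)
  qed (use k in auto)
  have E_mult: "E * \<rho> k = lam k \<cdot>\<^sub>m E" if k: "k \<in> H" for k
  proof (rule eq_matI)
    fix i j assume "i < dim_row (lam k \<cdot>\<^sub>m E)" "j < dim_col (lam k \<cdot>\<^sub>m E)"
    then have ij: "i < d" "j < d" using E by auto
    have "(E * \<rho> k) $$ (i, j) = (\<Sum>l<d. \<Sum>h\<in>H. lam (inv h) * (\<rho> h $$ (i, l) * \<rho> k $$ (l, j))) / card H"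
      using ij k by (simp add: mat_mult_index[of _ d] E_index sum_distrib_left sum_distrib_right sum_divide_distrib mult_ac)
    also have "\<dots> = (\<Sum>h\<in>H. lam (inv h) * \<rho> (h \<otimes> k) $$ (i, j)) / card H"
      using ij k by (subst sum.swap) (simp add: mat_mult_index[of _ d] mult sum_distrib_left)
    also have "(\<Sum>h\<in>H. lam (inv h) * \<rho> (h \<otimes> k) $$ (i, j)) = (\<Sum>h\<in>H. lam (inv (h \<otimes> inv k)) * \<rho> h $$ (i, j))"
      using k by (subst sum_H_right_translate[OF k, symmetric]) (auto simp: m_assoc intro!: sum.cong)
    also have "\<dots> = lam k * (\<Sum>h\<in>H. lam (inv h) * \<rho> h $$ (i, j))"
      using k by (auto simp: sum_distrib_left inv_mult_group lam_mult intro!: sum.cong)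
    finally show "(E * \<rho> k) $$ (i, j) = (lam k \<cdot>\<^sub>m E) $$ (i, j)"
      using ij E by (simp add: E_index)
  qed (use k in auto)
  have idem: "E * E = E"
  proof (rule eq_matI)
    fix i j assume "i < dim_row E" "j < dim_col E"
    then have ij: "i < d" "j < d" using E by auto
    have "(E * E) $$ (i, j) = (\<Sum>l<d. \<Sum>h\<in>H. lam (inv h) * (\<rho> h $$ (i, l) * E $$ (l, j))) / card H"
      using ij by (simp add: mat_mult_index[of _ d] E_index[of i] sum_distrib_left sum_distrib_right sum_divide_distrib mult_ac)
    also have "\<dots> = (\<Sum>h\<in>H. lam (inv h) * (\<rho> h * E) $$ (i, j)) / card H"
      using ij by (subst sum.swap) (simp add: mat_mult_index[of _ d] sum_distrib_left)
    also have "(\<Sum>h\<in>H. lam (inv h) * (\<rho> h * E) $$ (i, j)) = (\<Sum>h\<in>H. E $$ (i, j))"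
    proof (rule sum.cong[OF refl])
      fix h assume "h \<in> H"
      then show "lam (inv h) * (\<rho> h * E) $$ (i, j) = E $$ (i, j)"
        using ij E lam_inv[of h] by (simp add: mult_E flip: mult.assoc)
    qed
    finally show "(E * E) $$ (i, j) = E $$ (i, j)"
      using card_H_nonzero by simp
  qed (use E in auto)
  \<comment> \<open>For x outside H, moving k through x multiplies the product by
    \<open>lam k\<close> on one side and by the different value
    \<open>lam (inv x \<otimes> k \<otimes> x)\<close> on the other, so the product
    vanishes.\<close>
  have E_rho_E: "E * (\<rho> x * E) = lam0 x \<cdot>\<^sub>m E" if x: "x \<in> carrier G" for x
  proof (cases "x \<in> H")
    case True
    then show ?thesis
      by (simp add: mult_E mult_smult_distrib[of E d d E d] idem lam0_def)
  next
    case False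
    obtain k where k: "k \<in> H" "inv x \<otimes> k \<otimes> x \<in> H" "lam (inv x \<otimes> k \<otimes> x) \<noteq> lam k"
      using mackey[OF x False] by blast
    let ?k = "inv x \<otimes> k \<otimes> x" and ?M = "E * (\<rho> x * E)"
    have M: "?M \<in> carrier_mat d d" using x by simp
    have "k \<otimes> x = x \<otimes> ?k" using x k(1) by (simp add: m_assoc m_inv_cancel)
    then have "\<rho> k * \<rho> x = \<rho> x * \<rho> ?k"
      using x k(1) by (simp flip: mult)
    then have "E * ((\<rho> k * \<rho> x) * E) = E * ((\<rho> x * \<rho> ?k) * E)" by simp
    then have "(E * \<rho> k) * (\<rho> x * E) = E * (\<rho> x * (\<rho> ?k * E))"
      using x k(1) by (simp add: assoc)
    then have "(lam k \<cdot>\<^sub>m E) * (\<rho> x * E) = E * (\<rho> x * (lam ?k \<cdot>\<^sub>m E))"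
      using k by (simp add: E_mult mult_E)
    then have eq: "lam k \<cdot>\<^sub>m ?M = lam ?k \<cdot>\<^sub>m ?M"
      using x by (simp add: mult_smult_distrib[of _ d d _ d] mult_smult_assoc_mat[of _ d d _ d])
    have "?M $$ (i, j) = 0" if ij: "i < d" "j < d" for i j
    proof -
      have "lam k * ?M $$ (i, j) = lam ?k * ?M $$ (i, j)"
        using arg_cong[OF eq, of "\<lambda>M. M $$ (i, j)"] carrier_matD[OF M] ij by simp
      then show ?thesis using k(3) by (metis mult_right_cancel)
    qed
    then show ?thesis
      using M E False by (intro eq_matI) (auto simp: lam0_def)
  qed
  \<comment> \<open>The column j0 is nonzero because of its entry i0, and it lies in the image of
    E.\<close>
  define w where "w = col E j0"
  have w [simp]: "w \<in> carrier_vec d" "dim_vec w = d"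
    unfolding w_def using carrier_matD(1)[OF E(1)] by (auto intro!: carrier_vecI)
  have "w $ i0 \<noteq> 0"
    using ij0 E card_H_nonzero by (simp add: w_def E_index)
  then have w_nonzero: "w \<noteq> 0\<^sub>v d" using ij0 by auto
  have rho_w: "\<rho> x *\<^sub>v w = col (\<rho> x * E) j0" if "x \<in> carrier G" for x
    using that ij0 E by (simp add: w_def col_mult2[of _ d d _ d])
  have E_rho_w: "E *\<^sub>v (\<rho> x *\<^sub>v w) = lam0 x \<cdot>\<^sub>v w" if x: "x \<in> carrier G" for x
  proof -
    have "E *\<^sub>v (\<rho> x *\<^sub>v w) = col (E * (\<rho> x * E)) j0"
      using x ij0 by (simp add: rho_w col_mult2[of _ d d _ d])
    then show ?thesis using x ij0 E by (simp add: E_rho_E w_def)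
  qed
  \<comment> \<open>The condition quantifies over all x in order to be invariant under G;
    \<open>w\<close> satisfies it by \<open>E_rho_w\<close>. At x = \<open>\<one>\<close> it puts
    the image of E on the line through \<open>w\<close>.\<close>
  have rank_one: "{y \<in> carrier_vec d. \<forall>x\<in>carrier G. \<exists>c. E *\<^sub>v (\<rho> x *\<^sub>v y) = c \<cdot>\<^sub>v w} = carrier_vec d"
    (is "?W = _")
  proof (rule irreducible_representation_subspace[OF irr _ _ _ _ _ w_nonzero])
    show "w \<in> ?W" using E_rho_w by auto
  next
    fix u v assume uv: "u \<in> ?W" "v \<in> ?W"
    have "\<exists>c. E *\<^sub>v (\<rho> x *\<^sub>v (u + v)) = c \<cdot>\<^sub>v w" if x: "x \<in> carrier G" for x
    proof -
      obtain a b where "E *\<^sub>v (\<rho> x *\<^sub>v u) = a \<cdot>\<^sub>v w" "E *\<^sub>v (\<rho> x *\<^sub>v v) = b \<cdot>\<^sub>v w"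
        using uv x by blast
      then have "E *\<^sub>v (\<rho> x *\<^sub>v (u + v)) = (a + b) \<cdot>\<^sub>v w"
        using uv x by (simp add: mult_add_distrib_mat_vec[of _ d d] add_smult_distrib_vec)
      then show ?thesis by blast
    qed
    then show "u + v \<in> ?W" using uv by auto
  next
    fix a v assume v: "v \<in> ?W"
    have "\<exists>c. E *\<^sub>v (\<rho> x *\<^sub>v (a \<cdot>\<^sub>v v)) = c \<cdot>\<^sub>v w" if x: "x \<in> carrier G" for x
    proof -
      obtain b where "E *\<^sub>v (\<rho> x *\<^sub>v v) = b \<cdot>\<^sub>v w"
        using v x by blast
      then have "E *\<^sub>v (\<rho> x *\<^sub>v (a \<cdot>\<^sub>v v)) = (a * b) \<cdot>\<^sub>v w"
        using v x by (simp add: mult_mat_vec[of _ d d] smult_smult_assoc)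
      then show ?thesis by blast
    qed
    then show "a \<cdot>\<^sub>v v \<in> ?W" using v by auto
  next
    fix h v assume h: "h \<in> carrier G" and v: "v \<in> ?W"
    have "\<exists>c. E *\<^sub>v (\<rho> x *\<^sub>v (\<rho> h *\<^sub>v v)) = c \<cdot>\<^sub>v w" if x: "x \<in> carrier G" for x
    proof -
      have "E *\<^sub>v (\<rho> x *\<^sub>v (\<rho> h *\<^sub>v v)) = E *\<^sub>v (\<rho> (x \<otimes> h) *\<^sub>v v)"
        using v h x by (simp add: mult assoc_mult_mat_vec[of _ d d _ d])
      then show ?thesis using v m_closed[OF x h] by auto
    qed
    then show "\<rho> h *\<^sub>v v \<in> ?W"
      using v h by auto
  qed auto
  have "\<exists>c. \<forall>i<d. E $$ (i, j) = c * w $ i" if j: "j < d" for j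
  proof -
    have "unit_vec d j \<in> ?W" unfolding rank_one by simp
    then obtain c where "E *\<^sub>v (\<rho> \<one> *\<^sub>v unit_vec d j) = c \<cdot>\<^sub>v w" by blast
    then have "col E j = c \<cdot>\<^sub>v w"
      using j E by (simp add: one mat_mult_unit_vec[of _ d d])
    then have "\<forall>i<d. E $$ (i, j) = c * w $ i"
      using j by (simp add: vec_eq_iff)
    then show ?thesis by blast
  qed
  then obtain c where c: "\<And>i j. i < d \<Longrightarrow> j < d \<Longrightarrow> E $$ (i, j) = c j * w $ i"
    by metis
  \<comment> \<open>Column j of E is \<open>c j\<close> times \<open>w\<close>, so E multiplies
    \<open>w\<close> by the sum of all \<open>c j * w $ j\<close>, which is also the trace of E.
    Since E fixes \<open>w\<close> and \<open>w $ i0\<close> is nonzero, this factor is 1.\<close>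
  have "w $ i0 = (E *\<^sub>v (\<rho> \<one> *\<^sub>v w)) $ i0"
    using E_rho_w[of \<one>] by (simp add: lam0_def lam_one)
  also have "\<dots> = (\<Sum>j<d. c j * w $ j) * w $ i0"
    using ij0 by (simp add: one mat_mult_vec_index[of _ d] c sum_distrib_left mult_ac)
  finally have trace_E: "mat_trace E = 1"
    using \<open>w $ i0 \<noteq> 0\<close> E by (simp add: mat_trace_def c)
  have trace_rho_E: "mat_trace (\<rho> x * E) = lam0 x" if x: "x \<in> carrier G" for x
  proof -
    have "mat_trace (\<rho> x * E) = mat_trace ((\<rho> x * E) * E)"
      using x by (simp add: assoc idem)
    also have "\<dots> = mat_trace (E * (\<rho> x * E))"
      using x by (intro mat_trace_mult_commute[of _ d]) auto
    also have "\<dots> = lam0 x * mat_trace E"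
      using E x by (simp add: E_rho_E mat_trace_def sum_distrib_left)
    finally show ?thesis by (simp add: trace_E)
  qed
  \<comment> \<open>The conjugates of E. By \<open>Z_conj\<close> their sum commutes with the
    representation, so its effect on the single vector \<open>w\<close> determines it
    everywhere.\<close>
  define Z where "Z y = \<rho> y * E * \<rho> (inv y)" for y
  have Z [simp]: "Z y \<in> carrier_mat d d" if "y \<in> carrier G" for y
    using that by (simp add: Z_def)
  have dim_Z [simp]: "dim_row (Z y) = d" "dim_col (Z y) = d" if "y \<in> carrier G" for y
    using carrier_matD[OF Z[OF that]] by simp_all
  have Z_w: "Z y *\<^sub>v w = (if y \<in> H then w else 0\<^sub>v d)" if y: "y \<in> carrier G" for y
  proof -
    have "Z y *\<^sub>v w = \<rho> y *\<^sub>v (E *\<^sub>v (\<rho> (inv y) *\<^sub>v w))"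
      using y by (simp add: Z_def assoc_mult_mat_vec[of _ d d _ d])
    also have "\<dots> = lam0 (inv y) \<cdot>\<^sub>v (\<rho> y *\<^sub>v w)"
      using y by (simp add: E_rho_w mult_mat_vec[of _ d d])
    also have "\<dots> = (if y \<in> H then w else 0\<^sub>v d)"
    proof (cases "y \<in> H")
      case True
      have "\<rho> y *\<^sub>v w = lam y \<cdot>\<^sub>v w"
        unfolding rho_w[OF y] mult_E[OF True] using ij0 by (simp add: w_def)
      then show ?thesis
        using True lam_inv[OF True] by (simp add: lam0_def smult_smult_assoc)
    next
      case False
      then have "inv y \<notin> H" using y H.m_inv_closed[of "inv y"] by auto
      then show ?thesis
        using False y mult_mat_vec_carrier[OF carr[OF y] w(1)] by (auto simp: lam0_def)
    qed
    finally show ?thesis .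
  qed
  have Z_conj: "Z (h \<otimes> y) * \<rho> h = \<rho> h * Z y" if "h \<in> carrier G" "y \<in> carrier G" for h y
  proof -
    have "\<rho> (inv (h \<otimes> y)) * \<rho> h = \<rho> (inv y)"
      using that by (simp add: inv_mult_group m_assoc flip: mult)
    then show ?thesis
      using that by (simp add: Z_def assoc mult)
  qed
  \<comment> \<open>On \<open>w\<close> only the y in H contribute, each giving back
    \<open>w\<close>; this is where the scalar \<open>card H\<close> comes from.\<close>
  have scalar: "{v \<in> carrier_vec d. \<forall>i<d. (\<Sum>y\<in>carrier G. (Z y *\<^sub>v v) $ i) = card H * v $ i} = carrier_vec d"
    (is "?W = _")
  proof (rule irreducible_representation_subspace[OF irr _ _ _ _ _ w_nonzero])
    have "(\<Sum>y\<in>carrier G. (Z y *\<^sub>v w) $ i) = card H * w $ i" if i: "i < d" for i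
    proof -
      have "(\<Sum>y\<in>carrier G. (Z y *\<^sub>v w) $ i) = (\<Sum>y\<in>H. w $ i)"
        using i finite_G H.subset by (intro sum.mono_neutral_cong_right) (auto simp: Z_w)
      then show ?thesis by simp
    qed
    then show "w \<in> ?W" by auto
  next
    fix u v assume "u \<in> ?W" "v \<in> ?W"
    then show "u + v \<in> ?W"
      by (auto simp: mult_add_distrib_mat_vec[of _ d d] sum.distrib distrib_left)
  next
    fix a v assume "v \<in> ?W"
    then show "a \<cdot>\<^sub>v v \<in> ?W"
      by (auto simp: mult_mat_vec[of _ d d] simp flip: sum_distrib_left)
  next
    fix h v assume h: "h \<in> carrier G" and v: "v \<in> ?W"
    have hv: "\<rho> h *\<^sub>v v \<in> carrier_vec d"
      using h v by auto
    have "(\<Sum>y\<in>carrier G. (Z y *\<^sub>v (\<rho> h *\<^sub>v v)) $ i) = card H * (\<rho> h *\<^sub>v v) $ i" if i: "i < d" for i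
    proof -
      have "(\<Sum>y\<in>carrier G. (Z y *\<^sub>v (\<rho> h *\<^sub>v v)) $ i) = (\<Sum>y\<in>carrier G. (Z (h \<otimes> y) *\<^sub>v (\<rho> h *\<^sub>v v)) $ i)"
        by (rule sum.reindex_bij_witness[of _ "\<lambda>y. h \<otimes> y" "\<lambda>y. inv h \<otimes> y"])
          (use h in \<open>auto simp: m_inv_cancel\<close>)
      also have "\<dots> = (\<Sum>y\<in>carrier G. (\<rho> h *\<^sub>v (Z y *\<^sub>v v)) $ i)"
        using h v by (intro sum.cong refl) (simp add: Z_conj flip: assoc_mult_mat_vec[of _ d d _ d])
      also have "\<dots> = (\<Sum>y\<in>carrier G. \<Sum>l<d. \<rho> h $$ (i, l) * (Z y *\<^sub>v v) $ l)"
        using h v i by (intro sum.cong refl mat_mult_vec_index) auto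
      also have "\<dots> = (\<Sum>l<d. \<rho> h $$ (i, l) * (card H * v $ l))"
        using v by (subst sum.swap) (simp flip: sum_distrib_left)
      also have "\<dots> = card H * (\<rho> h *\<^sub>v v) $ i"
        using h v i by (simp add: mat_mult_vec_index[of _ d] sum_distrib_left mult_ac)
      finally show ?thesis .
    qed
    then show "\<rho> h *\<^sub>v v \<in> ?W" using hv by auto
  qed auto
  have Z_sum: "(\<Sum>y\<in>carrier G. Z y $$ (i, j)) = (if i = j then card H else 0)" if "i < d" "j < d" for i j
  proof -
    have "unit_vec d j \<in> ?W" unfolding scalar by simp
    then have "(\<Sum>y\<in>carrier G. (Z y *\<^sub>v unit_vec d j) $ i) = card H * (unit_vec d j :: complex vec) $ i"
      using that by auto
    moreover have "(Z y *\<^sub>v unit_vec d j) $ i = Z y $$ (i, j)" if "y \<in> carrier G" for y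
      using that \<open>i < d\<close> \<open>j < d\<close> Z[OF that] by (simp add: mat_mult_unit_vec[of _ d d])
    ultimately show ?thesis using that by (simp cong: sum.cong)
  qed
  \<comment> \<open>Cyclicity of the trace moves the conjugation from E to g. Summed over y, this
    yields the Frobenius sum on one side and \<open>card H\<close> times the trace of
    \<open>\<rho> g\<close> on the other.\<close>
  have "mat_trace (\<rho> g * Z y) = lam0 (inv y \<otimes> g \<otimes> y)" if y: "y \<in> carrier G" for y
  proof -
    have "mat_trace (\<rho> g * Z y) = mat_trace ((\<rho> (g \<otimes> y) * E) * \<rho> (inv y))"
      using g y by (simp add: Z_def mult assoc)
    also have "\<dots> = mat_trace (\<rho> (inv y) * (\<rho> (g \<otimes> y) * E))"
      using g y by (intro mat_trace_mult_commute[of _ d]) auto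
    also have "\<dots> = mat_trace (\<rho> (inv y \<otimes> g \<otimes> y) * E)"
      using g y by (simp add: mult assoc)
    finally show ?thesis using g y by (simp add: trace_rho_E)
  qed
  then have "(\<Sum>y\<in>carrier G. lam0 (inv y \<otimes> g \<otimes> y)) = (\<Sum>y\<in>carrier G. mat_trace (\<rho> g * Z y))"
    by simp
  also have "\<dots> = (\<Sum>y\<in>carrier G. \<Sum>i<d. \<Sum>l<d. \<rho> g $$ (i, l) * Z y $$ (l, i))"
    using carr[OF g] g by (intro sum.cong refl) (simp add: mat_trace_def mat_mult_index[of _ d])
  also have "\<dots> = (\<Sum>i<d. \<Sum>l<d. \<rho> g $$ (i, l) * (\<Sum>y\<in>carrier G. Z y $$ (l, i)))"
    by (subst sum.swap, intro sum.cong refl, subst sum.swap) (simp add: sum_distrib_left)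
  also have "\<dots> = (\<Sum>i<d. \<Sum>l<d. if l = i then \<rho> g $$ (i, i) * card H else 0)"
    by (intro sum.cong refl) (simp add: Z_sum)
  also have "\<dots> = mat_trace (\<rho> g) * card H"
    using carr[OF g] by (simp add: mat_trace_def sum_distrib_right)
  finally show ?thesis
    using card_H_nonzero by (simp add: ind_char_def)
qed

text \<open>The induced representation is realized by monomial matrices indexed by the right cosets
  of H. For irreducibility, twisted averages over H of translates of a nonzero vector produce every
  unit vector.\<close>

theorem exists_irreducible_ind_char:
  "\<exists>\<rho> d. irreducible_representation G d \<rho> \<and> (\<forall>g\<in>carrier G. mat_trace (\<rho> g) = ind_char g)"
proof -
  define d where "d = card (rcosets H)"
  have "finite (rcosets H)"
    using finite_G by (simp add: RCOSETS_def)
  then obtain b where b: "bij_betw b {..<d} (rcosets H)"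
    using ex_bij_betw_nat_finite[of "rcosets H"] by (auto simp: d_def atLeast0LessThan)
  have "\<exists>y\<in>carrier G. b i = H #> y" if "i < d" for i
    using bij_betw_apply[OF b, of i] that by (auto simp: RCOSETS_def)
  then obtain y where y: "\<And>i. i < d \<Longrightarrow> y i \<in> carrier G" and b_eq: "\<And>i. i < d \<Longrightarrow> b i = H #> y i"
    by metis
  have coset_iff: "x \<otimes> inv (y i) \<in> H \<longleftrightarrow> H #> x = b i" if "x \<in> carrier G" "i < d" for x i
    using that y[OF that(2)] b_eq[OF that(2)] H.rcos_module[OF group_axioms, of "y i" x]
      repr_independence[OF _ _ subgroup_H, of x "y i"] rcos_self[OF _ subgroup_H, of x]
    by auto
  \<comment> \<open>The \<open>y i\<close> form a transversal of the right cosets. The uniqueness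
    leaves exactly one nonzero entry in each row of the matrices defined below.\<close>
  have ex1: "\<exists>!i. i < d \<and> x \<otimes> inv (y i) \<in> H" if x: "x \<in> carrier G" for x
  proof -
    have "H #> x \<in> rcosets H" using x by (auto simp: RCOSETS_def)
    then obtain i where i: "i < d" "b i = H #> x"
      using bij_betw_imp_surj_on[OF b] by (metis imageE lessThan_iff)
    have "j = i" if "j < d" "x \<otimes> inv (y j) \<in> H" for j
      using that i coset_iff[OF x, of j] bij_betw_imp_inj_on[OF b] by (metis inj_onD lessThan_iff)
    moreover have "x \<otimes> inv (y i) \<in> H"
      using i coset_iff[OF x, of i] by simp
    ultimately show ?thesis using i(1) by blast
  qed
  have sum_single: "(\<Sum>k<d. lam0 (x \<otimes> inv (y k)) * F k) = lam0 (x \<otimes> inv (y i)) * F i"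
    if x: "x \<in> carrier G" and i: "i < d" "x \<otimes> inv (y i) \<in> H" for x i and F :: "nat \<Rightarrow> complex"
  proof -
    have "lam0 (x \<otimes> inv (y k)) = 0" if "k < d" "k \<noteq> i" for k
      using ex1[OF x] i that unfolding lam0_def by metis
    then have "(\<Sum>k<d. lam0 (x \<otimes> inv (y k)) * F k) = (\<Sum>k\<in>{i}. lam0 (x \<otimes> inv (y k)) * F k)"
      using i by (intro sum.mono_neutral_right) auto
    then show ?thesis by simp
  qed
  have diag: "lam0 (y i \<otimes> inv (y j)) = (if i = j then 1 else 0)" if "i < d" "j < d" for i j
  proof (cases "i = j")
    case True
    then show ?thesis using that y by (simp add: lam0_def lam_one)
  next
    case False
    moreover have "y i \<otimes> inv (y i) \<in> H" using that y by simp
    ultimately have "y i \<otimes> inv (y j) \<notin> H" using ex1[OF y[OF that(1)]] that by metis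
    then show ?thesis using False by (simp add: lam0_def)
  qed
  define \<rho> where "\<rho> g = mat d d (\<lambda>(i, j). lam0 (y i \<otimes> g \<otimes> inv (y j)))" for g
  have rho_index: "\<rho> g $$ (i, j) = lam0 (y i \<otimes> g \<otimes> inv (y j))" if "i < d" "j < d" for g i j
    using that by (simp add: \<rho>_def)
  have carr [simp]: "\<rho> g \<in> carrier_mat d d" for g by (simp add: \<rho>_def)
  have rep: "representation G d \<rho>"
  proof (rule representationI[OF group_axioms])
    show "\<rho> \<one> = 1\<^sub>m d"
      using y by (intro eq_matI) (auto simp: \<rho>_def diag)
  next
    fix g h assume gh: "g \<in> carrier G" "h \<in> carrier G"
    show "\<rho> (g \<otimes> h) = \<rho> g * \<rho> h"
    proof (rule eq_matI)
      fix i j assume "i < dim_row (\<rho> g * \<rho> h)" "j < dim_col (\<rho> g * \<rho> h)"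
      then have ij: "i < d" "j < d" by (simp_all add: \<rho>_def)
      have x: "y i \<otimes> g \<in> carrier G" using y ij gh by simp
      obtain k where k: "k < d" "y i \<otimes> g \<otimes> inv (y k) \<in> H" using ex1[OF x] by blast
      have "(\<rho> g * \<rho> h) $$ (i, j) = (\<Sum>l<d. \<rho> g $$ (i, l) * \<rho> h $$ (l, j))"
        using ij by (intro mat_mult_index) auto
      also have "\<dots> = (\<Sum>l<d. lam0 (y i \<otimes> g \<otimes> inv (y l)) * lam0 (y l \<otimes> h \<otimes> inv (y j)))"
        using ij by (simp add: rho_index)
      also have "\<dots> = lam0 (y i \<otimes> g \<otimes> inv (y k)) * lam0 (y k \<otimes> h \<otimes> inv (y j))"
        using sum_single[OF x k] .
      also have "\<dots> = lam0 ((y i \<otimes> g \<otimes> inv (y k)) \<otimes> (y k \<otimes> h \<otimes> inv (y j)))"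
        using k y ij gh by (simp add: lam0_mult_left) (simp add: lam0_def)
      also have "(y i \<otimes> g \<otimes> inv (y k)) \<otimes> (y k \<otimes> h \<otimes> inv (y j)) = y i \<otimes> (g \<otimes> h) \<otimes> inv (y j)"
        using k(1) y ij gh by (simp add: m_assoc m_inv_cancel)
      finally show "\<rho> (g \<otimes> h) $$ (i, j) = (\<rho> g * \<rho> h) $$ (i, j)"
        using ij by (simp add: rho_index)
    qed (simp_all add: \<rho>_def)
  qed simp
  have "W = {0\<^sub>v d} \<or> W = carrier_vec d"
    if W: "VectorSpace.subspace class_ring W (module_vec TYPE(complex) d)"
      and inv_W: "\<And>g w. g \<in> carrier G \<Longrightarrow> w \<in> W \<Longrightarrow> \<rho> g *\<^sub>v w \<in> W" for W
  proof (cases "W = {0\<^sub>v d}")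
    case False
    then obtain v where v: "v \<in> W" "v \<noteq> 0\<^sub>v d"
      using subspace_module_vec_zero[OF W] by blast
    then have vd: "v \<in> carrier_vec d" using subspace_module_vec_carrier[OF W] by blast
    with v(2) obtain m where m: "m < d" "v $ m \<noteq> 0"
      by (metis carrier_vecD eq_vecI index_zero_vec)
    have unit: "unit_vec d i \<in> W" if i: "i < d" for i
    proof -
      \<comment> \<open>These elements carry the coset of \<open>y m\<close> to that of
        \<open>y i\<close>. By \<open>lam0_convolution\<close> and \<open>diag\<close>, the twisted
        average over h kills every coordinate of v except the one at m and places it at i.\<close>
      let ?x = "\<lambda>h. inv (y i) \<otimes> h \<otimes> y m"
      let ?u = "vec d (\<lambda>k. \<Sum>h\<in>H. lam (inv h) * (\<rho> (?x h) *\<^sub>v v) $ k)"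
      have "?u \<in> W"
        using i m y v by (intro subspace_module_vec_sum[OF W finite_H] inv_W) auto
      moreover have "?u = (card H * v $ m) \<cdot>\<^sub>v unit_vec d i"
      proof (rule eq_vecI)
        fix k assume "k < dim_vec ((card H * v $ m) \<cdot>\<^sub>v unit_vec d i)"
        then have k: "k < d" by simp
        have "?u $ k = (\<Sum>h\<in>H. \<Sum>l<d. lam (inv h) * (\<rho> (?x h) $$ (k, l) * v $ l))"
          using k vd by (simp add: mat_mult_vec_index[of _ d] sum_distrib_left del: index_mult_mat_vec)
        also have "\<dots> = (\<Sum>l<d. \<Sum>h\<in>H. lam (inv h) * lam0 ((y k \<otimes> inv (y i)) \<otimes> h \<otimes> (y m \<otimes> inv (y l))) * v $ l)"
          using k i m y by (subst sum.swap, intro sum.cong refl) (simp add: rho_index m_assoc)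
        also have "\<dots> = (\<Sum>l<d. card H * lam0 (y k \<otimes> inv (y i)) * lam0 (y m \<otimes> inv (y l)) * v $ l)"
          using k i m y by (intro sum.cong refl) (simp add: lam0_convolution flip: sum_distrib_right)
        also have "\<dots> = (\<Sum>l<d. if m = l then card H * lam0 (y k \<otimes> inv (y i)) * v $ m else 0)"
          using m by (intro sum.cong refl) (simp add: diag)
        also have "\<dots> = card H * v $ m * (if k = i then 1 else 0)"
          using k i m by (simp add: diag)
        finally show "?u $ k = ((card H * v $ m) \<cdot>\<^sub>v unit_vec d i) $ k"
          using k i by simp
      qed simp
      ultimately have "(1 / (card H * v $ m)) \<cdot>\<^sub>v ((card H * v $ m) \<cdot>\<^sub>v unit_vec d i) \<in> W"
        using subspace_module_vec_smult[OF W] by simp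
      then show ?thesis
        using m card_H_nonzero by (simp add: smult_smult_assoc)
    qed
    have "u \<in> W" if u: "u \<in> carrier_vec d" for u
    proof -
      have "vec d (\<lambda>k. \<Sum>i\<in>{..<d}. u $ i * unit_vec d i $ k) \<in> W"
        using unit by (intro subspace_module_vec_sum[OF W]) auto
      also have "vec d (\<lambda>k. \<Sum>i\<in>{..<d}. u $ i * unit_vec d i $ k) = u"
      proof (rule eq_vecI)
        fix k assume "k < dim_vec u"
        then have k: "k < d" using u by simp
        have "(\<Sum>i\<in>{..<d}. u $ i * unit_vec d i $ k) = (\<Sum>i\<in>{..<d}. if k = i then u $ k else 0)"
          using k by (intro sum.cong refl) simp
        then show "vec d (\<lambda>k. \<Sum>i\<in>{..<d}. u $ i * unit_vec d i $ k) $ k = u $ k"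
          using k by simp
      qed (use u in simp)
      finally show ?thesis .
    qed
    then show ?thesis using subspace_module_vec_carrier[OF W] by blast
  qed simp
  moreover have "d > 0" using ex1[OF one_closed] by auto
  ultimately have "irreducible_representation G d \<rho>"
    using rep by (auto simp: irreducible_representation_def)
  moreover have "mat_trace (\<rho> g) = ind_char g" if g: "g \<in> carrier G" for g
  proof -
    have "(\<Sum>z\<in>carrier G. lam0 (inv z \<otimes> g \<otimes> z)) = (\<Sum>z\<in>carrier G. lam0 (z \<otimes> g \<otimes> inv z))"
      by (rule sum.reindex_bij_witness[of _ "\<lambda>z. inv z" "\<lambda>z. inv z"]) auto
    \<comment> \<open>Each z is uniquely h times some \<open>y i\<close> with h in H. Conjugation by
      h does not change \<open>lam0\<close>, so each representative is counted \<open>card H\<close>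
      times.\<close>
    also have "\<dots> = (\<Sum>p\<in>{..<d} \<times> H. lam0 ((snd p \<otimes> y (fst p)) \<otimes> g \<otimes> inv (snd p \<otimes> y (fst p))))"
    proof (rule sum.reindex_bij_betw[symmetric, where h = "\<lambda>p. snd p \<otimes> y (fst p)"])
      show "bij_betw (\<lambda>p. snd p \<otimes> y (fst p)) ({..<d} \<times> H) (carrier G)"
        unfolding bij_betw_def
      proof (intro conjI inj_onI equalityI subsetI)
        fix p q assume pq: "p \<in> {..<d} \<times> H" "q \<in> {..<d} \<times> H" "snd p \<otimes> y (fst p) = snd q \<otimes> y (fst q)"
        let ?x = "snd p \<otimes> y (fst p)"
        have x: "?x \<in> carrier G" using pq y by auto
        have cancel: "(h \<otimes> y i) \<otimes> inv (y i) = h" if "i < d" "h \<in> H" for h i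
          using that y by (simp add: m_assoc)
        have p: "?x \<otimes> inv (y (fst p)) = snd p" using cancel pq(1) by auto
        have q: "?x \<otimes> inv (y (fst q)) = snd q" unfolding pq(3) using cancel pq(2) by auto
        have "fst p < d" "fst q < d" "snd p \<in> H" "snd q \<in> H"
          using pq(1,2) by (auto simp: mem_Times_iff)
        then have "fst p = fst q" using ex1[OF x] p q by metis
        then show "p = q" using p q by (simp add: prod_eq_iff)
      next
        fix z assume z: "z \<in> carrier G"
        then obtain i where "i < d" "z \<otimes> inv (y i) \<in> H" using ex1 by blast
        moreover from this have "z = (z \<otimes> inv (y i)) \<otimes> y i" using z y by (simp add: m_assoc)
        ultimately show "z \<in> (\<lambda>p. snd p \<otimes> y (fst p)) ` ({..<d} \<times> H)" by force
      qed (use y in auto)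
    qed
    also have "\<dots> = (\<Sum>p\<in>{..<d} \<times> H. lam0 (y (fst p) \<otimes> g \<otimes> inv (y (fst p))))"
    proof (intro sum.cong refl, clarsimp)
      fix i h assume i: "i < d" and h: "h \<in> H"
      have "(h \<otimes> y i) \<otimes> g \<otimes> inv (h \<otimes> y i) = h \<otimes> (y i \<otimes> g \<otimes> inv (y i)) \<otimes> inv h"
        using i h y g by (simp add: inv_mult_group m_assoc)
      then show "lam0 ((h \<otimes> y i) \<otimes> g \<otimes> inv (h \<otimes> y i)) = lam0 (y i \<otimes> g \<otimes> inv (y i))"
        using i h y g lam_inv[OF h] by (simp add: lam0_mult_left lam0_mult_right mult.commute)
    qed
    also have "\<dots> = card H * mat_trace (\<rho> g)"
      using sum.cartesian_product[of "\<lambda>i h. lam0 (y i \<otimes> g \<otimes> inv (y i))" H "{..<d}"]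
      by (simp add: mat_trace_def \<rho>_def sum_distrib_left case_prod_unfold)
    finally show ?thesis
      using card_H_nonzero by (simp add: ind_char_def)
  qed
  ultimately show ?thesis by blast
qed

end

section \<open>Irreducible characters of \<open>B \<rtimes> V\<close>\<close>

text \<open>The sign (-1)^b. The target ring is left open: characters take complex values, while the
  congruence modulo p concerns integers.\<close>

definition bsgn :: "bit \<Rightarrow> 'a :: ring_1" where
  "bsgn b = (if b = 0 then 1 else -1)"

lemma bsgn_simps [simp]: "bsgn 0 = 1" "bsgn 1 = -1"
  by (simp_all add: bsgn_def)

lemma bsgn_add: "bsgn (a + b) = bsgn a * bsgn b"
  by (cases a; cases b) simp_all

lemma of_int_bsgn [simp]: "of_int (bsgn b) = bsgn b"
  by (simp add: bsgn_def)

lemma finite_carrier_vec_bit [simp]: "finite (carrier_vec n :: bit vec set)"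
  by (rule card_ge_0_finite) (simp add: card_carrier_vec_bit)

lemma finite_funs [simp]: "finite (funs n)"
  by (simp add: funs_def finite_PiE UNIV_bit_eq)

lemma bit_vec_add_cancel [simp]:
  fixes x t :: "bit vec"
  assumes "x \<in> carrier_vec n" "t \<in> carrier_vec n"
  shows "x + (t + t) = x" and "t + (t + x) = x"
  using assms bit_vec_add_self[OF assms(2)] by (simp_all flip: assoc_add_vec[of t n t x])

section \<open>The group B of functions on V and its self-duality\<close>

definition fun_zero :: "nat \<Rightarrow> bit vec \<Rightarrow> bit" where
  "fun_zero n = (\<lambda>x\<in>carrier_vec n. 0)"

definition fun_add :: "nat \<Rightarrow> (bit vec \<Rightarrow> bit) \<Rightarrow> (bit vec \<Rightarrow> bit) \<Rightarrow> bit vec \<Rightarrow> bit" where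
  "fun_add n f g = (\<lambda>x\<in>carrier_vec n. f x + g x)"

lemma funs_eqI:
  assumes "f \<in> funs n" "g \<in> funs n" "\<And>x. x \<in> carrier_vec n \<Longrightarrow> f x = g x"
  shows "f = g"
  using assms by (auto simp: funs_def PiE_def intro: extensionalityI)

lemma fun_zero_funs [simp]: "fun_zero n \<in> funs n"
  and fun_add_funs [simp]: "fun_add n f g \<in> funs n"
  and translate_funs [simp]: "translate n t f \<in> funs n"
  by (simp_all add: fun_zero_def fun_add_def translate_def funs_def)

lemma translate_apply [simp]: "x \<in> carrier_vec n \<Longrightarrow> translate n t f x = f (x + t)"
  by (simp add: translate_def)

lemma fun_add_apply [simp]: "x \<in> carrier_vec n \<Longrightarrow> fun_add n f g x = f x + g x"
  by (simp add: fun_add_def)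

lemma fun_zero_apply [simp]: "x \<in> carrier_vec n \<Longrightarrow> fun_zero n x = 0"
  by (simp add: fun_zero_def)

lemma translate_zero [simp]: "f \<in> funs n \<Longrightarrow> translate n (0\<^sub>v n) f = f"
  by (rule funs_eqI[of _ n]) auto

lemma translate_translate:
  assumes "s \<in> carrier_vec n" "t \<in> carrier_vec n"
  shows "translate n s (translate n t f) = translate n (s + t) f"
  by (rule funs_eqI[of _ n]) (use assms in \<open>auto simp: assoc_add_vec[of _ n]\<close>)

lemma fun_add_self [simp]: "fun_add n f f = fun_zero n"
  by (rule funs_eqI[of _ n]) (auto simp: bit_add_self)

lemma fun_add_eq_zero_iff:
  assumes "f \<in> funs n" "g \<in> funs n"
  shows "fun_add n f g = fun_zero n \<longleftrightarrow> f = g"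
proof
  assume eq: "fun_add n f g = fun_zero n"
  have "f x + g x = 0" if "x \<in> carrier_vec n" for x
    using fun_cong[OF eq, of x] that by simp
  then have "f x = g x" if "x \<in> carrier_vec n" for x
    using that by (cases "f x"; cases "g x") fastforce+
  then show "f = g" by (rule funs_eqI[OF assms])
qed simp

text \<open>The form T . f; through \<open>bsgn\<close>, each T in B gives a linear character of
  B.\<close>

definition pairing :: "nat \<Rightarrow> (bit vec \<Rightarrow> bit) \<Rightarrow> (bit vec \<Rightarrow> bit) \<Rightarrow> bit" where
  "pairing n T f = (\<Sum>x\<in>carrier_vec n. T x * f x)"

lemma pairing_commute: "pairing n T f = pairing n f T"
  by (simp only: pairing_def mult.commute)

lemma pairing_add_right: "pairing n T (fun_add n f g) = pairing n T f + pairing n T g"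
  unfolding pairing_def sum.distrib[symmetric] by (intro sum.cong refl) (simp only: fun_add_apply distrib_left)

lemma pairing_add_left: "pairing n (fun_add n f g) T = pairing n f T + pairing n g T"
  unfolding pairing_def sum.distrib[symmetric] by (intro sum.cong refl) (simp only: fun_add_apply distrib_right)

lemma bsgn_square [simp]: "bsgn a * bsgn a = 1" "bsgn a * (bsgn a * x) = x"
  by (simp_all add: bsgn_def)

lemma
  shows bsgn_pairing_add_right: "bsgn (pairing n T (fun_add n f g)) = bsgn (pairing n T f) * bsgn (pairing n T g)"
    and bsgn_pairing_add_left: "bsgn (pairing n (fun_add n f g) T) = bsgn (pairing n f T) * bsgn (pairing n g T)"
  by (simp_all only: pairing_add_right pairing_add_left bsgn_add)

lemma bsgn_scalar_prod_add:
  assumes "u \<in> carrier_vec n" "s \<in> carrier_vec n" "t \<in> carrier_vec n"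
  shows "bsgn (u \<bullet> (s + t)) = bsgn (u \<bullet> s) * bsgn (u \<bullet> t)"
  by (simp only: scalar_prod_add_distrib[OF assms] bsgn_add)

lemma pairing_zero [simp]: "pairing n (fun_zero n) f = 0" "pairing n f (fun_zero n) = 0"
  by (simp_all add: pairing_def)

text \<open>Translations are self-adjoint because adding t is an involution in characteristic
  2.\<close>

lemma pairing_translate:
  assumes "t \<in> carrier_vec n"
  shows "pairing n T (translate n t f) = pairing n (translate n t T) f"
  unfolding pairing_def
  by (rule sum.reindex_bij_witness[of _ "\<lambda>x. x + t" "\<lambda>x. x + t"]) (use assms in auto)

section \<open>Orthogonality relations for the characters of B and V\<close>

lemma sum_eq_zero_of_negating_involution:
  fixes F :: "'b \<Rightarrow> complex"
  assumes "\<And>x. x \<in> S \<Longrightarrow> \<sigma> x \<in> S" "\<And>x. x \<in> S \<Longrightarrow> \<sigma> (\<sigma> x) = x" "\<And>x. x \<in> S \<Longrightarrow> F (\<sigma> x) = - F x"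
  shows "sum F S = 0"
proof -
  have "sum F S = (\<Sum>x\<in>S. - F x)"
    by (rule sum.reindex_bij_witness[of _ \<sigma> \<sigma>]) (use assms in auto)
  then show ?thesis by (simp add: sum_negf)
qed

lemma exists_pairing_eq_one:
  assumes "T \<in> funs n" "T \<noteq> fun_zero n"
  shows "\<exists>k\<in>funs n. pairing n T k = 1"
proof -
  obtain x where x: "x \<in> carrier_vec n" "T x = 1"
    using assms funs_eqI[OF assms(1) fun_zero_funs] by (metis bit_not_zero_iff fun_zero_apply)
  define k where "k = (\<lambda>y\<in>carrier_vec n. if y = x then 1 else 0 :: bit)"
  have "pairing n T k = (\<Sum>y\<in>carrier_vec n. if y = x then T x else 0)"
    unfolding pairing_def by (intro sum.cong refl) (simp add: k_def)
  also have "\<dots> = 1" using x by simp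
  finally show ?thesis by (auto simp: k_def funs_def)
qed

lemma sum_bsgn_pairing:
  assumes T: "T \<in> funs n"
  shows "(\<Sum>f\<in>funs n. bsgn (pairing n T f) :: complex) = (if T = fun_zero n then card (funs n) else 0)"
proof (cases "T = fun_zero n")
  case False
  then obtain k where k: "k \<in> funs n" "pairing n T k = 1"
    using exists_pairing_eq_one[OF T] by blast
  have "fun_add n (fun_add n f k) k = f" if "f \<in> funs n" for f
    using that by (intro funs_eqI[of _ n]) (auto simp: add.assoc bit_add_self)
  then have "(\<Sum>f\<in>funs n. bsgn (pairing n T f) :: complex) = 0"
    by (intro sum_eq_zero_of_negating_involution[of _ "\<lambda>f. fun_add n f k"])
      (auto simp: bsgn_pairing_add_right k)
  then show ?thesis using False by simp
qed simp

text \<open>The product of the characters given by T and S is the one given by T + S, which is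
  trivial exactly when T = S.\<close>

lemma sum_bsgn_pairing_mult:
  assumes "T \<in> funs n" "S \<in> funs n"
  shows "(\<Sum>f\<in>funs n. bsgn (pairing n T f) * bsgn (pairing n S f) :: complex) = (if T = S then card (funs n) else 0)"
  using sum_bsgn_pairing[of "fun_add n T S" n] assms
  by (simp add: bsgn_pairing_add_left fun_add_eq_zero_iff)

lemma sum_bsgn_scalar_prod:
  assumes t: "t \<in> carrier_vec n"
  shows "(\<Sum>u\<in>carrier_vec n. bsgn (u \<bullet> t) :: complex) = (if t = 0\<^sub>v n then card (carrier_vec n :: bit vec set) else 0)"
proof (cases "t = 0\<^sub>v n")
  case False
  then obtain i where i: "i < n" "t $ i = 1"
    using t by (metis bit_not_zero_iff carrier_vecD eq_vecI index_zero_vec)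
  have "(u + unit_vec n i) \<bullet> t = u \<bullet> t + 1" if "u \<in> carrier_vec n" for u
    using that t i by (simp add: add_scalar_prod_distrib[of _ n] scalar_prod_left_unit)
  then have "(\<Sum>u\<in>carrier_vec n. bsgn (u \<bullet> t) :: complex) = 0"
    by (intro sum_eq_zero_of_negating_involution[of _ "\<lambda>u. u + unit_vec n i"])
      (auto simp: bsgn_add)
  then show ?thesis using False by simp
qed simp

section \<open>Stabilizers under translation\<close>

definition stab :: "nat \<Rightarrow> (bit vec \<Rightarrow> bit) \<Rightarrow> bit vec set" where
  "stab n T = {t \<in> carrier_vec n. translate n t T = T}"

lemma stab_carrier: "t \<in> stab n T \<Longrightarrow> t \<in> carrier_vec n"
  by (simp add: stab_def)

lemma finite_stab [simp]: "finite (stab n T)"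
  by (rule finite_subset[OF _ finite_carrier_vec_bit]) (auto simp: stab_def)

lemma zero_in_stab: "T \<in> funs n \<Longrightarrow> 0\<^sub>v n \<in> stab n T"
  by (simp add: stab_def)

lemma stab_add: "s \<in> stab n T \<Longrightarrow> t \<in> stab n T \<Longrightarrow> s + t \<in> stab n T"
  by (auto simp: stab_def simp flip: translate_translate)

text \<open>In characteristic 2, s + t is the difference of s and t, so this is the usual
  description of orbit points by cosets of the stabilizer.\<close>

lemma translate_eq_iff_stab:
  assumes "T \<in> funs n" "s \<in> carrier_vec n" "t \<in> carrier_vec n"
  shows "translate n s T = translate n t T \<longleftrightarrow> s + t \<in> stab n T"
proof
  assume "translate n s T = translate n t T"
  then have "translate n s (translate n s T) = translate n s (translate n t T)" by simp
  then show "s + t \<in> stab n T"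
    using assms by (simp add: translate_translate stab_def bit_vec_add_self)
next
  assume "s + t \<in> stab n T"
  then have "translate n s (translate n (s + t) T) = translate n s T" by (simp add: stab_def)
  then show "translate n s T = translate n t T"
    using assms by (simp add: translate_translate)
qed

text \<open>Points of one orbit have conjugate stabilizers, and V is abelian.\<close>

lemma stab_translate:
  assumes "T \<in> funs n" "s \<in> carrier_vec n"
  shows "stab n (translate n s T) = stab n T"
proof -
  have "translate n t (translate n s T) = translate n s T \<longleftrightarrow> translate n t T = T"
    if "t \<in> carrier_vec n" for t
  proof -
    have "t + s + s = t" using that assms(2) by simp
    then show ?thesis
      using that assms translate_eq_iff_stab[OF assms(1), of "t + s" s]
      by (simp add: translate_translate stab_def)
  qed
  then show ?thesis by (auto simp: stab_def)
qed

section \<open>Inertia groups in the semidirect product and their induced characters\<close>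

lemma carrier_semidirect: "carrier (semidirect n) = funs n \<times> carrier_vec n"
  by (simp add: semidirect_def)

lemma mult_semidirect: "(f, t) \<otimes>\<^bsub>semidirect n\<^esub> (g, s) = (fun_add n f (translate n t g), t + s)"
  by (simp add: semidirect_def fun_add_def)

lemma one_semidirect: "\<one>\<^bsub>semidirect n\<^esub> = (fun_zero n, 0\<^sub>v n)"
  by (simp add: semidirect_def fun_zero_def)

lemma inv_semidirect:
  assumes "f \<in> funs n" "t \<in> carrier_vec n"
  shows "inv\<^bsub>semidirect n\<^esub> (f, t) = (translate n t f, t)"
proof (rule group.inv_equality[OF group_semidirect])
  show "(translate n t f, t) \<otimes>\<^bsub>semidirect n\<^esub> (f, t) = \<one>\<^bsub>semidirect n\<^esub>"
    using assms by (simp add: mult_semidirect one_semidirect bit_vec_add_self)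
qed (use assms in \<open>auto simp: carrier_semidirect\<close>)

text \<open>On the inertia group, the extension of the character of B given by T, twisted by the
  character of V given by u.\<close>

definition inertia_char :: "nat \<Rightarrow> (bit vec \<Rightarrow> bit) \<Rightarrow> bit vec \<Rightarrow> (bit vec \<Rightarrow> bit) \<times> bit vec \<Rightarrow> complex" where
  "inertia_char n T u = (\<lambda>(f, t). bsgn (pairing n T f) * bsgn (u \<bullet> t))"

lemma inertia_char_apply [simp]: "inertia_char n T u (f, t) = bsgn (pairing n T f) * bsgn (u \<bullet> t)"
  by (simp add: inertia_char_def)

lemma pairing_translate_stab: "t \<in> stab n T \<Longrightarrow> pairing n T (translate n t f) = pairing n T f"
  by (simp add: pairing_translate stab_def)

text \<open>For t outside the stabilizer, T and its translate by t give different characters of B,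
  so some k separates them. Conjugating (k, 0) by (f, t) only translates k, as the two contributions
  of f cancel; hence (k, 0) witnesses the Mackey condition.\<close>

lemma mackey_character_semidirect:
  assumes T: "T \<in> funs n" and u: "u \<in> carrier_vec n"
  shows "mackey_character (semidirect n) (funs n \<times> stab n T) (inertia_char n T u)"
proof -
  interpret G: group "semidirect n" by (rule group_semidirect)
  show ?thesis
  proof (intro mackey_character.intro group_semidirect mackey_character_axioms.intro)
    show "finite (carrier (semidirect n))" by (simp add: carrier_semidirect)
    show "subgroup (funs n \<times> stab n T) (semidirect n)"
      using zero_in_stab[OF T]
      by (intro G.subgroupI)
        (auto simp: carrier_semidirect stab_carrier inv_semidirect mult_semidirect stab_add intro: fun_zero_funs)
    show "inertia_char n T u \<one>\<^bsub>semidirect n\<^esub> = 1"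
      using u by (simp add: one_semidirect)
  next
    fix x y assume "x \<in> funs n \<times> stab n T" "y \<in> funs n \<times> stab n T"
    then obtain f t g s where "x = (f, t)" "y = (g, s)" "t \<in> stab n T" "s \<in> stab n T" by auto
    then show "inertia_char n T u (x \<otimes>\<^bsub>semidirect n\<^esub> y) = inertia_char n T u x * inertia_char n T u y"
      by (simp add: mult_semidirect bsgn_pairing_add_right pairing_translate_stab
          bsgn_scalar_prod_add[OF u] stab_carrier)
  next
    fix x assume "x \<in> carrier (semidirect n)" "x \<notin> funs n \<times> stab n T"
    then obtain f t where x: "x = (f, t)" "f \<in> funs n" "t \<in> carrier_vec n" "t \<notin> stab n T"
      by (auto simp: carrier_semidirect)
    then have "translate n t T \<noteq> T" by (simp add: stab_def)
    then obtain k where k: "k \<in> funs n" "pairing n (fun_add n (translate n t T) T) k = 1"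
      using exists_pairing_eq_one[of "fun_add n (translate n t T) T" n] T by (auto simp: fun_add_eq_zero_iff)
    have "inv\<^bsub>semidirect n\<^esub> x \<otimes>\<^bsub>semidirect n\<^esub> (k, 0\<^sub>v n) \<otimes>\<^bsub>semidirect n\<^esub> x
        = (fun_add n (fun_add n (translate n t f) (translate n t k)) (translate n t f), 0\<^sub>v n)"
      using x by (simp add: inv_semidirect mult_semidirect bit_vec_add_self)
    moreover have "bsgn (pairing n (translate n t T) k) \<noteq> (bsgn (pairing n T k) :: complex)"
      using arg_cong[OF k(2), of "bsgn :: bit \<Rightarrow> complex"] by (auto simp: bsgn_pairing_add_left)
    ultimately show "\<exists>h\<in>funs n \<times> stab n T.
        inv\<^bsub>semidirect n\<^esub> x \<otimes>\<^bsub>semidirect n\<^esub> h \<otimes>\<^bsub>semidirect n\<^esub> x \<in> funs n \<times> stab n T \<and>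
        inertia_char n T u (inv\<^bsub>semidirect n\<^esub> x \<otimes>\<^bsub>semidirect n\<^esub> h \<otimes>\<^bsub>semidirect n\<^esub> x) \<noteq> inertia_char n T u h"
      using x k(1) u zero_in_stab[OF T]
      by (intro bexI[of _ "(k, 0\<^sub>v n)"])
        (auto simp: bsgn_pairing_add_right pairing_translate mult_ac)
  qed
qed

text \<open>The closed form of the character induced from \<open>inertia_char\<close>. Each point of
  the orbit of T occurs \<open>card (stab n T)\<close> times in the sum over v, so after the
  division every orbit point counts once.\<close>

definition semidirect_char :: "nat \<Rightarrow> (bit vec \<Rightarrow> bit) \<Rightarrow> bit vec \<Rightarrow> (bit vec \<Rightarrow> bit) \<times> bit vec \<Rightarrow> complex" where
  "semidirect_char n T u = (\<lambda>(f, t)\<in>carrier (semidirect n).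
     if t \<in> stab n T
     then bsgn (u \<bullet> t) * (\<Sum>v\<in>carrier_vec n. bsgn (pairing n (translate n v T) f)) / of_nat (card (stab n T))
     else 0)"

lemma semidirect_char_apply:
  assumes "f \<in> funs n" "t \<in> carrier_vec n"
  shows "semidirect_char n T u (f, t) = (if t \<in> stab n T
     then bsgn (u \<bullet> t) * (\<Sum>v\<in>carrier_vec n. bsgn (pairing n (translate n v T) f)) / of_nat (card (stab n T))
     else 0)"
  using assms by (simp add: semidirect_char_def carrier_semidirect)

text \<open>Conjugation by (k, v) leaves t unchanged. When t stabilizes T, the two contributions of
  k have equal signs and cancel, so the sum over k is the factor \<open>card (funs n)\<close>, which
  the order of the inertia group absorbs.\<close>

lemma ind_char_semidirect:
  assumes T: "T \<in> funs n" and u: "u \<in> carrier_vec n" and g: "g \<in> carrier (semidirect n)"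
  shows "mackey_character.ind_char (semidirect n) (funs n \<times> stab n T) (inertia_char n T u) g
    = semidirect_char n T u g"
proof -
  interpret mackey_character "semidirect n" "funs n \<times> stab n T" "inertia_char n T u"
    using T u by (rule mackey_character_semidirect)
  obtain f t where ft: "g = (f, t)" "f \<in> funs n" "t \<in> carrier_vec n"
    using g by (auto simp: carrier_semidirect)
  let ?F = "\<lambda>v. if t \<in> stab n T then bsgn (u \<bullet> t) * bsgn (pairing n (translate n v T) f) else 0 :: complex"
  have "lam0 (inv\<^bsub>semidirect n\<^esub> (k, v) \<otimes>\<^bsub>semidirect n\<^esub> g \<otimes>\<^bsub>semidirect n\<^esub> (k, v)) = ?F v"
    if k: "k \<in> funs n" and v: "v \<in> carrier_vec n" for k v
  proof -
    have vt: "v + t + v = t"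
      using ft v by (simp add: comm_add_vec[of v n t])
    have "inv\<^bsub>semidirect n\<^esub> (k, v) \<otimes>\<^bsub>semidirect n\<^esub> g \<otimes>\<^bsub>semidirect n\<^esub> (k, v) =
       (fun_add n (fun_add n (translate n v k) (translate n v f)) (translate n (v + t) k), t)"
      using k v ft vt by (simp add: inv_semidirect mult_semidirect)
    moreover have "pairing n T (translate n (v + t) k) = pairing n T (translate n v k)" if "t \<in> stab n T"
      using that v ft translate_translate[of v n t T] by (simp add: pairing_translate stab_def)
    ultimately show ?thesis
      using v by (simp add: lam0_def bsgn_pairing_add_right pairing_translate mult_ac)
  qed
  then have "(\<Sum>y\<in>carrier (semidirect n). lam0 (inv\<^bsub>semidirect n\<^esub> y \<otimes>\<^bsub>semidirect n\<^esub> g \<otimes>\<^bsub>semidirect n\<^esub> y)) =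
     (\<Sum>(k, v)\<in>funs n \<times> carrier_vec n. ?F v)"
    unfolding carrier_semidirect by (intro sum.cong refl) auto
  also have "\<dots> = card (funs n) * (\<Sum>v\<in>carrier_vec n. ?F v)"
    by (simp flip: sum.cartesian_product)
  finally have "ind_char g = (\<Sum>v\<in>carrier_vec n. ?F v) / of_nat (card (stab n T))"
    using fun_zero_funs[of n] by (auto simp: ind_char_def card_cartesian_product simp del: fun_zero_funs)
  then show ?thesis
    using ft by (simp add: semidirect_char_apply sum_distrib_left)
qed

text \<open>If all these sums vanished, so would their total over T and u. By orthogonality the
  total is |V| |B| times the entry (0, 0) of the identity matrix, which is nonzero. This supplies
  the entry required by \<open>irreducible_trace_eq_ind_char\<close>.\<close>

lemma exists_nonzero_isotypic_component:
  assumes irr: "irreducible_representation (semidirect n) d \<rho>"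
  shows "\<exists>T\<in>funs n. \<exists>u\<in>carrier_vec n.
    (\<Sum>h\<in>funs n \<times> stab n T. inertia_char n T u (inv\<^bsub>semidirect n\<^esub> h) * \<rho> h $$ (0, 0)) \<noteq> 0"
proof (rule ccontr)
  have rep: "representation (semidirect n) d \<rho>" and d: "d > 0"
    using irr by (simp_all add: irreducible_representation_def)
  let ?r = "\<lambda>f t. \<rho> (f, t) $$ (0, 0)" and ?V = "carrier_vec n :: bit vec set"
  assume "\<not> ?thesis"
  then have "0 = (\<Sum>T\<in>funs n. \<Sum>u\<in>?V. \<Sum>h\<in>funs n \<times> stab n T.
      inertia_char n T u (inv\<^bsub>semidirect n\<^esub> h) * \<rho> h $$ (0, 0))"
    by simp
  also have "\<dots> = (\<Sum>T\<in>funs n. \<Sum>u\<in>?V. \<Sum>f\<in>funs n. \<Sum>t\<in>stab n T.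
      bsgn (pairing n T f) * bsgn (u \<bullet> t) * ?r f t)"
    by (simp add: sum.cartesian_product, intro sum.cong refl)
      (auto simp: inv_semidirect stab_carrier pairing_translate_stab)
  also have "\<dots> = (\<Sum>T\<in>funs n. \<Sum>f\<in>funs n. \<Sum>t\<in>stab n T. bsgn (pairing n T f) * ?r f t * (\<Sum>u\<in>?V. bsgn (u \<bullet> t)))"
  proof (rule sum.cong[OF refl])
    fix T
    have "(\<Sum>u\<in>?V. \<Sum>f\<in>funs n. \<Sum>t\<in>stab n T. bsgn (pairing n T f) * bsgn (u \<bullet> t) * ?r f t) =
        (\<Sum>f\<in>funs n. \<Sum>u\<in>?V. \<Sum>t\<in>stab n T. bsgn (pairing n T f) * bsgn (u \<bullet> t) * ?r f t)"
      by (rule sum.swap)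
    also have "\<dots> = (\<Sum>f\<in>funs n. \<Sum>t\<in>stab n T. \<Sum>u\<in>?V. bsgn (pairing n T f) * bsgn (u \<bullet> t) * ?r f t)"
      by (rule sum.cong[OF refl], rule sum.swap)
    also have "\<dots> = (\<Sum>f\<in>funs n. \<Sum>t\<in>stab n T. bsgn (pairing n T f) * ?r f t * (\<Sum>u\<in>?V. bsgn (u \<bullet> t)))"
      by (simp add: sum_distrib_left sum_distrib_right mult_ac)
    finally show "(\<Sum>u\<in>?V. \<Sum>f\<in>funs n. \<Sum>t\<in>stab n T. bsgn (pairing n T f) * bsgn (u \<bullet> t) * ?r f t) =
        (\<Sum>f\<in>funs n. \<Sum>t\<in>stab n T. bsgn (pairing n T f) * ?r f t * (\<Sum>u\<in>?V. bsgn (u \<bullet> t)))" .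
  qed
  \<comment> \<open>Summing over u first leaves only t = 0. This removes the range
    \<open>stab n T\<close>, which depends on T, before orthogonality is applied to the sum over
    T.\<close>
  also have "\<dots> = (\<Sum>T\<in>funs n. \<Sum>f\<in>funs n. \<Sum>t\<in>stab n T.
      if t = 0\<^sub>v n then bsgn (pairing n T f) * ?r f (0\<^sub>v n) * card ?V else 0)"
    by (intro sum.cong refl) (simp add: sum_bsgn_scalar_prod stab_carrier)
  also have "\<dots> = (\<Sum>T\<in>funs n. \<Sum>f\<in>funs n. bsgn (pairing n T f) * ?r f (0\<^sub>v n) * card ?V)"
    by (intro sum.cong refl) (simp add: zero_in_stab)
  also have "\<dots> = (\<Sum>f\<in>funs n. ?r f (0\<^sub>v n) * card ?V * (\<Sum>T\<in>funs n. bsgn (pairing n f T)))"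
    by (subst sum.swap) (simp add: sum_distrib_left sum_distrib_right mult_ac pairing_commute)
  also have "\<dots> = (\<Sum>f\<in>funs n. if f = fun_zero n then ?r f (0\<^sub>v n) * card ?V * card (funs n) else 0)"
    by (intro sum.cong refl) (simp add: sum_bsgn_pairing)
  also have "\<dots> = card ?V * card (funs n)"
    using representation_one[OF group_semidirect rep] d by (simp add: one_semidirect)
  also have "\<dots> \<noteq> 0"
    using fun_zero_funs[of n] by (auto simp: card_carrier_vec_bit simp del: fun_zero_funs)
  finally show False by simp
qed

theorem Irr_semidirect:
  "Irr (semidirect n) = {semidirect_char n T u | T u. T \<in> funs n \<and> u \<in> carrier_vec n}"
proof (intro equalityI subsetI)
  fix \<chi> assume "\<chi> \<in> Irr (semidirect n)"
  then obtain \<rho> d where irr: "irreducible_representation (semidirect n) d \<rho>"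
    and \<chi>: "\<chi> = (\<lambda>g\<in>carrier (semidirect n). mat_trace (\<rho> g))"
    by (auto simp: Irr_def)
  then have d: "d > 0" by (simp add: irreducible_representation_def)
  obtain T u where Tu: "T \<in> funs n" "u \<in> carrier_vec n"
    "(\<Sum>h\<in>funs n \<times> stab n T. inertia_char n T u (inv\<^bsub>semidirect n\<^esub> h) * \<rho> h $$ (0, 0)) \<noteq> 0"
    using exists_nonzero_isotypic_component[OF irr] by blast
  have "\<chi> = semidirect_char n T u"
    unfolding \<chi> using mackey_character.irreducible_trace_eq_ind_char[OF mackey_character_semidirect[OF Tu(1,2)] irr d d Tu(3)]
      ind_char_semidirect[OF Tu(1,2)]
    by (intro extensionalityI[of _ "carrier (semidirect n)"]) (auto simp: semidirect_char_def)
  then show "\<chi> \<in> {semidirect_char n T u | T u. T \<in> funs n \<and> u \<in> carrier_vec n}"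
    using Tu by blast
next
  fix \<chi> assume "\<chi> \<in> {semidirect_char n T u | T u. T \<in> funs n \<and> u \<in> carrier_vec n}"
  then obtain T u where Tu: "\<chi> = semidirect_char n T u" "T \<in> funs n" "u \<in> carrier_vec n" by blast
  obtain \<rho> d where \<rho>: "irreducible_representation (semidirect n) d \<rho>"
    "\<And>g. g \<in> carrier (semidirect n) \<Longrightarrow> mat_trace (\<rho> g) = semidirect_char n T u g"
    using mackey_character.exists_irreducible_ind_char[OF mackey_character_semidirect[OF Tu(2,3)]]
      ind_char_semidirect[OF Tu(2,3)] by fastforce
  have "\<chi> = (\<lambda>g\<in>carrier (semidirect n). mat_trace (\<rho> g))"
    using \<rho>(2) unfolding Tu(1)
    by (intro extensionalityI[of _ "carrier (semidirect n)"]) (auto simp: semidirect_char_def)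
  then show "\<chi> \<in> Irr (semidirect n)" using \<rho>(1) by (auto simp: Irr_def)
qed

text \<open>Replacing T by a translate only reindexes the sum over v.\<close>

lemma semidirect_char_translate:
  assumes "T \<in> funs n" "s \<in> carrier_vec n"
  shows "semidirect_char n (translate n s T) u = semidirect_char n T u"
proof -
  have "(\<Sum>v\<in>carrier_vec n. bsgn (pairing n (translate n v (translate n s T)) f) :: complex) =
      (\<Sum>v\<in>carrier_vec n. bsgn (pairing n (translate n v T) f))" for f
    by (rule sum.reindex_bij_witness[of _ "\<lambda>v. v + s" "\<lambda>v. v + s"])
      (use assms in \<open>auto simp: translate_translate\<close>)
  then show ?thesis
    using assms by (intro extensionalityI[of _ "carrier (semidirect n)"])
      (auto simp: semidirect_char_def stab_translate)
qed

text \<open>Restricted to B, the character is a sum over the orbit of T, and its Fourier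
  coefficients detect which S lie in that orbit. This recovers the orbit of T from the
  character.\<close>

lemma semidirect_char_fourier:
  assumes T: "T \<in> funs n" and S: "S \<in> funs n" and u: "u \<in> carrier_vec n"
  shows "(\<Sum>f\<in>funs n. semidirect_char n T u (f, 0\<^sub>v n) * bsgn (pairing n S f)) \<noteq> 0
    \<longleftrightarrow> (\<exists>v\<in>carrier_vec n. S = translate n v T)"
proof -
  let ?V = "carrier_vec n :: bit vec set"
  have "(\<Sum>f\<in>funs n. semidirect_char n T u (f, 0\<^sub>v n) * bsgn (pairing n S f)) =
      (\<Sum>f\<in>funs n. \<Sum>v\<in>?V. bsgn (pairing n (translate n v T) f) * bsgn (pairing n S f)) / of_nat (card (stab n T))"
    using u zero_in_stab[OF T]
    by (simp add: semidirect_char_apply sum_distrib_right sum_divide_distrib)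
  also have "\<dots> = (\<Sum>v\<in>?V. if translate n v T = S then of_nat (card (funs n)) else 0) / of_nat (card (stab n T))"
    using S by (subst sum.swap) (simp add: sum_bsgn_pairing_mult if_distrib[of of_nat] cong: if_cong)
  also have "\<dots> = of_nat (card {v \<in> ?V. translate n v T = S} * card (funs n)) / of_nat (card (stab n T))"
    by (simp add: sum.If_cases Int_def)
  finally show ?thesis
    using zero_in_stab[OF T] fun_zero_funs[of n] by (auto simp: simp del: fun_zero_funs)
qed

section \<open>Fixed-point-free actions of \<open>p\<close>-groups\<close>

text \<open>Orbits have p-power length and F is constant on each of them. An orbit of length 1 is a
  fixed point and cancels; any other orbit contributes a multiple of p.\<close>

lemma (in group_action) sum_cong_sum_fixed_points:
  fixes F :: "'c \<Rightarrow> int"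
  assumes p: "prime p" and ord: "Coset.order G = p ^ k" and fin: "finite E"
    and inv: "\<And>g x. g \<in> carrier G \<Longrightarrow> x \<in> E \<Longrightarrow> F (\<phi> g x) = F x"
  shows "int p dvd sum F E - sum F (fixed_points G \<phi> E)"
proof -
  have fix_sum: "sum F (fixed_points G \<phi> E) = (\<Sum>x\<in>E. if x \<in> fixed_points G \<phi> E then F x else 0)"
    using fin by (subst sum.inter_restrict[symmetric]) (auto simp: fixed_points_def intro: sum.cong)
  have "int p dvd (\<Sum>x\<in>orb. F x - (if x \<in> fixed_points G \<phi> E then F x else 0))"
    if orb: "orb \<in> orbits G E \<phi>" for orb
  proof -
    obtain x where x: "x \<in> E" and orb_eq: "orb = orbit G \<phi> x"
      using orb by (auto simp: orbits_def)
    have F_orb: "F y = F x" if "y \<in> orb" for y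
      using that inv x by (auto simp: orb_eq orbit_def)
    have "card orb dvd p ^ k"
      using orbit_stabilizer_theorem[OF x] ord by (metis dvd_triv_left orb_eq)
    then obtain i where i: "card orb = p ^ i"
      using divides_primepow_nat[OF p] by blast
    have x_orb: "x \<in> orb" using orbit_refl[OF x] orb_eq by simp
    show ?thesis
    proof (cases "i = 0")
      case True
      then obtain z where "orb = {z}" using i card_1_singletonE[of orb] by auto
      then have "orb = {x}" using x_orb by simp
      then have "x \<in> fixed_points G \<phi> E"
        using x by (auto simp: fixed_points_def orb_eq orbit_def)
      then show ?thesis using \<open>orb = {x}\<close> by simp
    next
      case False
      \<comment> \<open>A fixed point in the orbit would make the orbit a singleton, contrary to its
        length being a positive power of p.\<close>
      have "y \<notin> fixed_points G \<phi> E" if y: "y \<in> orb" for y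
      proof
        assume fy: "y \<in> fixed_points G \<phi> E"
        have "y \<in> E" using fy by (simp add: fixed_points_def)
        then have "x \<in> orbit G \<phi> y" using orbit_sym[OF x] y orb_eq by blast
        then have "x = y" using fy by (auto simp: fixed_points_def orbit_def)
        then have "orb = {y}"
          using fy group.is_monoid[OF group_hom.axioms(1)[OF group_hom]]
          by (auto simp: orb_eq orbit_def fixed_points_def monoid.one_closed intro!: exI[of _ "\<one>"])
        then have "p ^ i = 1" using i by simp
        then show False using False p by (simp add: prime_nat_iff)
      qed
      then have "(\<Sum>x\<in>orb. F x - (if x \<in> fixed_points G \<phi> E then F x else 0)) = (\<Sum>y\<in>orb. F x)"
        using F_orb by (intro sum.cong) auto
      then show ?thesis using i False by (simp add: dvd_power)
    qed
  qed
  then have "int p dvd (\<Sum>orb\<in>orbits G E \<phi>. \<Sum>x\<in>orb. F x - (if x \<in> fixed_points G \<phi> E then F x else 0))"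
    by (rule dvd_sum)
  then show ?thesis
    unfolding disjoint_sum[OF fin] fix_sum sum_subtractf .
qed

section \<open>Finite sums of vectors over F_2\<close>

text \<open>Defined by coordinates because the zero vector depends on the dimension: the empty sum
  has to be the zero vector of dimension n.\<close>

definition vec_sum :: "nat \<Rightarrow> ('i \<Rightarrow> bit vec) \<Rightarrow> 'i set \<Rightarrow> bit vec" where
  "vec_sum n g I = vec n (\<lambda>i. \<Sum>a\<in>I. g a $ i)"

lemma vec_sum_carrier [simp]: "vec_sum n g I \<in> carrier_vec n"
  by (simp add: vec_sum_def)

lemma vec_sum_empty: "vec_sum n g {} = 0\<^sub>v n"
  by (simp add: vec_sum_def zero_vec_def)

lemma vec_sum_insert:
  assumes "finite I" "a \<notin> I" "g a \<in> carrier_vec n"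
  shows "vec_sum n g (insert a I) = g a + vec_sum n g I"
  using assms by (intro eq_vecI) (auto simp: vec_sum_def)

lemma vec_sum_cong: "(\<And>a. a \<in> I \<Longrightarrow> g a = h a) \<Longrightarrow> vec_sum n g I = vec_sum n h I"
  by (simp add: vec_sum_def)

lemma vec_sum_add:
  assumes "\<And>a. a \<in> I \<Longrightarrow> g a \<in> carrier_vec n" "\<And>a. a \<in> I \<Longrightarrow> h a \<in> carrier_vec n"
  shows "vec_sum n (\<lambda>a. g a + h a) I = vec_sum n g I + vec_sum n h I"
proof (rule eq_vecI)
  fix i assume "i < dim_vec (vec_sum n g I + vec_sum n h I)"
  then have i: "i < n" by (simp add: vec_sum_def)
  have "(g a + h a) $ i = g a $ i + h a $ i" if "a \<in> I" for a
    using assms[OF that] i by (intro index_add_vec) auto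
  then show "vec_sum n (\<lambda>a. g a + h a) I $ i = (vec_sum n g I + vec_sum n h I) $ i"
    using i by (simp only: vec_sum_def index_vec index_add_vec dim_vec sum.distrib cong: sum.cong)
qed (simp add: vec_sum_def)

lemma of_nat_bit_odd: "odd m \<Longrightarrow> (of_nat m :: bit) = 1"
  by (auto elim!: oddE)

text \<open>This replaces division by the order in averages over A: an odd number of equal summands
  in characteristic 2 leaves one of them.\<close>

lemma vec_sum_const_odd:
  assumes "odd (card I)" "v \<in> carrier_vec n"
  shows "vec_sum n (\<lambda>_. v) I = v"
  using assms(2) of_nat_bit_odd[OF assms(1)]
  by (intro eq_vecI) (simp_all only: vec_sum_def index_vec dim_vec sum_constant mult_1_left carrier_vecD)

lemma vec_sum_closed:
  assumes "finite I" "0\<^sub>v n \<in> S" "S \<subseteq> carrier_vec n" "\<And>v w. v \<in> S \<Longrightarrow> w \<in> S \<Longrightarrow> v + w \<in> S"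
    and "\<And>a. a \<in> I \<Longrightarrow> g a \<in> S"
  shows "vec_sum n g I \<in> S"
  using assms(1,5)
  by (induction I rule: finite_induct) (use assms(2-4) in \<open>auto simp: vec_sum_empty vec_sum_insert subset_iff\<close>)

lemma scalar_prod_vec_sum:
  assumes "finite I" "u \<in> carrier_vec n" "\<And>a. a \<in> I \<Longrightarrow> g a \<in> carrier_vec n"
  shows "u \<bullet> vec_sum n g I = (\<Sum>a\<in>I. u \<bullet> g a)"
  using assms(1,3)
proof (induction I rule: finite_induct)
  case empty
  then show ?case using assms(2) by (simp add: vec_sum_empty)
next
  case (insert a I)
  have "u \<bullet> vec_sum n g (insert a I) = u \<bullet> g a + u \<bullet> vec_sum n g I"
    unfolding vec_sum_insert[where g = g, OF insert.hyps insert.prems[OF insertI1]]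
    by (rule scalar_prod_add_distrib[OF assms(2) insert.prems[OF insertI1] vec_sum_carrier])
  also have "u \<bullet> vec_sum n g I = (\<Sum>a\<in>I. u \<bullet> g a)"
    by (rule insert.IH) (rule insert.prems, simp)
  finally show ?case unfolding sum.insert[OF insert.hyps] .
qed

section \<open>The action of A on V: congruence modulo p and absence of balanced sets\<close>

locale fixed_point_free_action = group A for A (structure) +
  fixes p n :: nat and \<phi> :: "'a \<Rightarrow> bit vec \<Rightarrow> bit vec"
  assumes prime_p: "prime p" and odd_p: "odd p"
    and finite_A: "finite (carrier A)" and p_group: "\<exists>k. Coset.order A = p ^ k"
    and linear: "linear_action A n \<phi>"
    and fixed_zero: "fixed_points A \<phi> (carrier_vec n) = {0\<^sub>v n}"
begin

sublocale V: group_action A "carrier_vec n" \<phi>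
  using linear by (simp add: linear_action_def)

abbreviation "V \<equiv> carrier_vec n :: bit vec set"

lemma act_closed [simp]: "a \<in> carrier A \<Longrightarrow> v \<in> V \<Longrightarrow> \<phi> a v \<in> V"
  using V.element_image by blast

lemma act_add: "a \<in> carrier A \<Longrightarrow> v \<in> V \<Longrightarrow> w \<in> V \<Longrightarrow> \<phi> a (v + w) = \<phi> a v + \<phi> a w"
  using linear by (auto simp: linear_action_def)

lemma act_mult: "a \<in> carrier A \<Longrightarrow> b \<in> carrier A \<Longrightarrow> v \<in> V \<Longrightarrow> \<phi> (a \<otimes> b) v = \<phi> a (\<phi> b v)"
  using V.composition_rule by blast

lemma act_one [simp]: "v \<in> V \<Longrightarrow> \<phi> \<one> v = v"
  using V.id_eq_one by (metis restrict_apply')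

lemma act_inv [simp]:
  assumes "a \<in> carrier A" "v \<in> V"
  shows "\<phi> (inv a) (\<phi> a v) = v" and "\<phi> a (\<phi> (inv a) v) = v"
  using assms by (simp_all flip: act_mult)

lemma act_zero [simp]: "a \<in> carrier A \<Longrightarrow> \<phi> a (0\<^sub>v n) = 0\<^sub>v n"
  using fixed_zero by (auto simp: fixed_points_def)

lemma odd_card_A: "odd (card (carrier A))"
  using p_group odd_p by (auto simp: Coset.order_def)

lemma sum_act:
  assumes "a \<in> carrier A"
  shows "(\<Sum>v\<in>V. F (\<phi> a v)) = (\<Sum>v\<in>V. F v)"
  by (rule sum.reindex_bij_witness[of _ "\<phi> (inv a)" "\<phi> a"]) (use assms in auto)

lemma sum_cong_zero:
  fixes F :: "bit vec \<Rightarrow> int"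
  assumes "\<And>a v. a \<in> carrier A \<Longrightarrow> v \<in> V \<Longrightarrow> F (\<phi> a v) = F v"
  shows "int p dvd sum F V - F (0\<^sub>v n)"
proof -
  obtain k where "Coset.order A = p ^ k" using p_group by blast
  then show ?thesis
    using V.sum_cong_sum_fixed_points[OF prime_p _ finite_carrier_vec_bit assms] fixed_zero by simp
qed

lemma p_not_dvd_unit: "\<not> int p dvd 1" "\<not> int p dvd - 1"
  using prime_p by (auto simp: prime_nat_iff)

lemma not_balanced: "\<not> balanced A n \<phi>"
proof
  assume "balanced A n \<phi>"
  then obtain S where S: "S \<subseteq> V" "\<And>a v. a \<in> carrier A \<Longrightarrow> v \<in> S \<Longrightarrow> \<phi> a v \<in> S" "2 * card S = card V"
    unfolding balanced_def by (metis image_subset_iff)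
  have "\<phi> a v \<in> S \<longleftrightarrow> v \<in> S" if "a \<in> carrier A" "v \<in> V" for a v
    using that S(2)[of a v] S(2)[of "inv a" "\<phi> a v"] by auto
  then have "int p dvd (\<Sum>v\<in>V. if v \<in> S then 1 else 0) - (if 0\<^sub>v n \<in> S then 1 else 0)"
    by (intro sum_cong_zero) auto
  moreover have "V \<inter> S = S" using S(1) by auto
  ultimately have 1: "int p dvd int (card S) - (if 0\<^sub>v n \<in> S then 1 else 0)"
    by (simp flip: sum.inter_restrict)
  have "int (card V) = 2 * int (card S)" using S(3) by linarith
  moreover have "int p dvd (\<Sum>v\<in>V. 1) - 1"
    by (rule sum_cong_zero) auto
  ultimately have "int p dvd 2 * int (card S) - 1" by simp
  \<comment> \<open>The card S terms cancel and leave 2e - 1, where e is 1 or 0 according to whether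
    S contains the zero vector; this is 1 or -1.\<close>
  then have "int p dvd (2 * int (card S) - 1) - 2 * (int (card S) - (if 0\<^sub>v n \<in> S then 1 else 0))"
    using 1 by (meson dvd_diff dvd_mult)
  then show False using p_not_dvd_unit by (simp split: if_splits)
qed

section \<open>Averaging over A\<close>

lemma vec_sum_act:
  assumes "b \<in> carrier A" "finite I" "\<And>a. a \<in> I \<Longrightarrow> g a \<in> V"
  shows "\<phi> b (vec_sum n g I) = vec_sum n (\<lambda>a. \<phi> b (g a)) I"
  using assms(2,3)
  by (induction I rule: finite_induct) (use assms(1) in \<open>auto simp: vec_sum_empty vec_sum_insert act_add\<close>)

lemma vec_sum_reindex:
  assumes "bij_betw h (carrier A) (carrier A)"
  shows "vec_sum n (\<lambda>a. g (h a)) (carrier A) = vec_sum n g (carrier A)"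
  unfolding vec_sum_def by (subst sum.reindex_bij_betw[OF assms, of "\<lambda>a. g a $ _"]) simp

lemma bij_mult_left: "b \<in> carrier A \<Longrightarrow> bij_betw (\<lambda>a. b \<otimes> a) (carrier A) (carrier A)"
  by (rule bij_betwI[of _ _ _ "\<lambda>a. inv b \<otimes> a"]) (auto simp: m_inv_cancel)

lemma bij_mult_right: "b \<in> carrier A \<Longrightarrow> bij_betw (\<lambda>a. a \<otimes> b) (carrier A) (carrier A)"
  by (rule bij_betwI[of _ _ _ "\<lambda>a. a \<otimes> inv b"]) (auto simp: m_assoc)

text \<open>The sum over an A-orbit with multiplicities is fixed by A, and only the zero vector is
  fixed.\<close>

lemma norm_eq_zero:
  assumes v: "v \<in> V"
  shows "vec_sum n (\<lambda>a. \<phi> a v) (carrier A) = 0\<^sub>v n"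
proof -
  have "\<phi> b (vec_sum n (\<lambda>a. \<phi> a v) (carrier A)) = vec_sum n (\<lambda>a. \<phi> a v) (carrier A)"
    if b: "b \<in> carrier A" for b
    using vec_sum_reindex[OF bij_mult_left[OF b], of "\<lambda>a. \<phi> a v"] v b
    by (simp add: vec_sum_act finite_A act_mult cong: vec_sum_cong)
  then show ?thesis
    using fixed_zero by (auto simp: fixed_points_def)
qed

section \<open>The action of A on B and the A-invariant functions\<close>

definition act_fun :: "'a \<Rightarrow> (bit vec \<Rightarrow> bit) \<Rightarrow> bit vec \<Rightarrow> bit" where
  "act_fun a f = (\<lambda>x\<in>V. f (\<phi> (inv a) x))"

definition inv_funs :: "(bit vec \<Rightarrow> bit) set" where
  "inv_funs = {f \<in> funs n. \<forall>a\<in>carrier A. \<forall>x\<in>V. f (\<phi> a x) = f x}"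

lemma inv_funsD: "f \<in> inv_funs \<Longrightarrow> f \<in> funs n"
  "f \<in> inv_funs \<Longrightarrow> a \<in> carrier A \<Longrightarrow> x \<in> V \<Longrightarrow> f (\<phi> a x) = f x"
  by (auto simp: inv_funs_def)

lemma act_fun_funs [simp]: "act_fun a f \<in> funs n"
  by (simp add: act_fun_def funs_def)

lemma act_fun_apply [simp]: "x \<in> V \<Longrightarrow> act_fun a f x = f (\<phi> (inv a) x)"
  by (simp add: act_fun_def)

lemma act_fun_inv [simp]:
  assumes "a \<in> carrier A" "f \<in> funs n"
  shows "act_fun (inv a) (act_fun a f) = f" "act_fun a (act_fun (inv a) f) = f"
  using assms by (auto intro!: funs_eqI[of _ n])

lemma sum_act_fun:
  assumes "a \<in> carrier A"
  shows "(\<Sum>f\<in>funs n. F (act_fun a f)) = (\<Sum>f\<in>funs n. F f)"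
  by (rule sum.reindex_bij_witness[of _ "act_fun (inv a)" "act_fun a"]) (use assms in auto)

lemma act_fun_eq_iff: "f \<in> funs n \<Longrightarrow> (\<forall>a\<in>carrier A. act_fun a f = f) \<longleftrightarrow> f \<in> inv_funs"
proof
  assume f: "f \<in> funs n" and *: "\<forall>a\<in>carrier A. act_fun a f = f"
  have "f (\<phi> a x) = f x" if "a \<in> carrier A" "x \<in> V" for a x
    using fun_cong[OF *[rule_format, OF inv_closed[OF that(1)]], of x] that by simp
  then show "f \<in> inv_funs" using f by (simp add: inv_funs_def)
next
  assume "f \<in> inv_funs"
  then show "\<forall>a\<in>carrier A. act_fun a f = f"
    by (auto intro!: funs_eqI[of _ n] simp: inv_funsD)
qed

lemma semidirect_action_apply:
  assumes "f \<in> funs n" "t \<in> V"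
  shows "semidirect_action A n \<phi> a (f, t) = (act_fun a f, \<phi> a t)"
  using assms by (simp add: semidirect_action_def carrier_semidirect act_fun_def)

lemma fixed_points_semidirect:
  "fixed_points A (semidirect_action A n \<phi>) (carrier (semidirect n)) = inv_funs \<times> {0\<^sub>v n}"
proof -
  have "(f, t) \<in> fixed_points A (semidirect_action A n \<phi>) (carrier (semidirect n)) \<longleftrightarrow>
      f \<in> inv_funs \<and> t \<in> fixed_points A \<phi> V" for f t
    using act_fun_eq_iff[of f] inv_funsD(1)[of f]
    by (auto simp: fixed_points_def carrier_semidirect semidirect_action_apply)
  then show ?thesis using fixed_zero by auto
qed

lemma pairing_act_fun:
  assumes "a \<in> carrier A"
  shows "pairing n (act_fun a T) (act_fun a f) = pairing n T f"
proof -
  have "pairing n (act_fun a T) (act_fun a f) = (\<Sum>x\<in>V. T (\<phi> (inv a) x) * f (\<phi> (inv a) x))"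
    unfolding pairing_def by (intro sum.cong refl) (simp only: act_fun_apply)
  also have "\<dots> = pairing n T f"
    unfolding pairing_def by (rule sum_act[OF inv_closed[OF assms]])
  finally show ?thesis .
qed

text \<open>By linearity and invariance of T, T(a^-1 x + v) = T(x + a v).\<close>

lemma act_fun_translate:
  assumes "T \<in> inv_funs" "a \<in> carrier A" "v \<in> V"
  shows "act_fun a (translate n v T) = translate n (\<phi> a v) T"
proof (rule funs_eqI[of _ n])
  fix x assume x: "x \<in> V"
  have "T (\<phi> (inv a) x + v) = T (\<phi> a (\<phi> (inv a) x + v))"
    using assms x by (simp only: inv_funsD add_carrier_vec act_closed inv_closed)
  then show "act_fun a (translate n v T) x = translate n (\<phi> a v) T x"
    using assms x by (simp add: act_add)
qed auto

lemma stab_act: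
  assumes "T \<in> inv_funs" "a \<in> carrier A" "t \<in> V"
  shows "\<phi> a t \<in> stab n T \<longleftrightarrow> t \<in> stab n T"
proof -
  have 1: "\<phi> b s \<in> stab n T" if "b \<in> carrier A" "s \<in> stab n T" for b s
    using that assms(1) act_fun_translate[of T b s] act_fun_eq_iff[OF inv_funsD(1)[OF assms(1)]]
    by (simp add: stab_def)
  show ?thesis
    using 1[of a t] 1[of "inv a" "\<phi> a t"] assms by auto
qed

lemma stab_vec_sum:
  assumes "T \<in> funs n" "\<And>a. a \<in> carrier A \<Longrightarrow> g a \<in> stab n T"
  shows "vec_sum n g (carrier A) \<in> stab n T"
  using assms zero_in_stab[OF assms(1)]
  by (intro vec_sum_closed finite_A) (auto simp: stab_add stab_carrier)

text \<open>Summed over A, the vectors \<open>v + \<phi> a v\<close> give v: the first summands add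
  up to v since the order of A is odd, the second ones to zero by \<open>norm_eq_zero\<close>. When
  the stabilizer is A-stable, this says that the quotient of V by it has no nonzero fixed
  vector.\<close>

lemma in_stab_of_all_differences:
  assumes T: "T \<in> funs n" and v: "v \<in> V" and *: "\<And>a. a \<in> carrier A \<Longrightarrow> v + \<phi> a v \<in> stab n T"
  shows "v \<in> stab n T"
proof -
  have "vec_sum n (\<lambda>a. v + \<phi> a v) (carrier A) = vec_sum n (\<lambda>_. v) (carrier A) + vec_sum n (\<lambda>a. \<phi> a v) (carrier A)"
    using v by (intro vec_sum_add) auto
  also have "\<dots> = v" using v by (simp add: norm_eq_zero vec_sum_const_odd odd_card_A)
  finally show ?thesis using stab_vec_sum[OF T, of "\<lambda>a. v + \<phi> a v"] * by simp
qed

section \<open>The A-invariant irreducible characters\<close>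

lemma semidirect_char_invariant:
  assumes T: "T \<in> inv_funs" and a: "a \<in> carrier A" and f: "f \<in> funs n" and t: "t \<in> V"
  shows "semidirect_char n T (0\<^sub>v n) (act_fun a f, \<phi> a t) = semidirect_char n T (0\<^sub>v n) (f, t)"
proof -
  have "(\<Sum>v\<in>V. bsgn (pairing n (translate n v T) (act_fun a f)) :: complex) =
      (\<Sum>v\<in>V. bsgn (pairing n (translate n (\<phi> a v) T) (act_fun a f)))"
    using sum_act[OF a, of "\<lambda>v. bsgn (pairing n (translate n v T) (act_fun a f)) :: complex"] by simp
  also have "\<dots> = (\<Sum>v\<in>V. bsgn (pairing n (translate n v T) f))"
    using a T by (intro sum.cong refl) (simp add: pairing_act_fun flip: act_fun_translate)
  finally show ?thesis
    using assms by (simp add: semidirect_char_apply stab_act)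
qed

lemma semidirect_char_nonzero:
  assumes T: "T \<in> inv_funs" and f: "f \<in> inv_funs"
  shows "semidirect_char n T (0\<^sub>v n) (f, 0\<^sub>v n) \<noteq> 0"
proof -
  \<comment> \<open>The signs are taken in the integers, where the sum is congruent to F(0), a unit,
    modulo p; its nonvanishing is then transported to the complex numbers.\<close>
  define F where "F v = (bsgn (pairing n (translate n v T) f) :: int)" for v
  have "F (\<phi> a v) = F v" if a: "a \<in> carrier A" and v: "v \<in> V" for a v
  proof -
    have "act_fun a f = f" using act_fun_eq_iff[OF inv_funsD(1)[OF f]] f a by blast
    then show ?thesis
      using pairing_act_fun[OF a, of "translate n v T" f] T a v by (simp add: F_def act_fun_translate)
  qed
  then have "int p dvd sum F V - F (0\<^sub>v n)" by (rule sum_cong_zero)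
  moreover have "\<not> int p dvd F (0\<^sub>v n)" using p_not_dvd_unit by (simp add: F_def bsgn_def)
  ultimately have "sum F V \<noteq> 0" by auto
  then have "(of_int (sum F V) :: complex) \<noteq> 0" unfolding of_int_eq_0_iff .
  then have "(\<Sum>v\<in>V. bsgn (pairing n (translate n v T) f) :: complex) \<noteq> 0"
    by (simp add: F_def)
  then show ?thesis
    using zero_in_stab[OF inv_funsD(1)[OF T]] f by (auto simp: semidirect_char_apply inv_funsD)
qed

text \<open>By \<open>semidirect_char_fourier\<close>, S is the translate of T by some v. As both
  are A-invariant, translating T by v or by \<open>\<phi> a v\<close> has the same effect, so every
  \<open>v + \<phi> a v\<close> stabilizes T, and hence v does too.\<close>

lemma inj_on_semidirect_char: "inj_on (\<lambda>T. semidirect_char n T (0\<^sub>v n)) inv_funs"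
proof (rule inj_onI)
  fix T S assume T: "T \<in> inv_funs" and S: "S \<in> inv_funs"
    and eq: "semidirect_char n T (0\<^sub>v n) = semidirect_char n S (0\<^sub>v n)"
  note TS = inv_funsD(1)[OF T] inv_funsD(1)[OF S]
  have "\<exists>v\<in>V. S = translate n v S" using TS by (intro bexI[of _ "0\<^sub>v n"]) auto
  then have "\<exists>v\<in>V. S = translate n v T"
    using semidirect_char_fourier[OF TS(2) TS(2) zero_carrier_vec] semidirect_char_fourier[OF TS(1) TS(2) zero_carrier_vec]
    unfolding eq by blast
  then obtain v where v: "v \<in> V" "S = translate n v T" by blast
  have "v + \<phi> a v \<in> stab n T" if a: "a \<in> carrier A" for a
  proof -
    have "translate n (\<phi> a v) T = translate n v T"
      using act_fun_translate[OF T a v(1)] act_fun_eq_iff[OF TS(2)] S a v(2) by auto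
    then show ?thesis using translate_eq_iff_stab[OF TS(1)] a v(1) by (metis act_closed)
  qed
  then have "v \<in> stab n T" by (rule in_stab_of_all_differences[OF TS(1) v(1)])
  then show "T = S" using v by (simp add: stab_def)
qed

text \<open>The translations relating \<open>T\<close> to its conjugates form a cocycle modulo the stabilizer;
  since \<open>card A\<close> is odd, summing it over \<open>A\<close> exhibits it as a coboundary.\<close>

lemma exists_invariant_translate:
  assumes T: "T \<in> funs n" and orb: "\<And>a. a \<in> carrier A \<Longrightarrow> \<exists>v\<in>V. act_fun a T = translate n v T"
  shows "\<exists>s\<in>V. translate n s T \<in> inv_funs"
proof -
  \<comment> \<open>The hypothesis is used at \<open>inv a\<close>, so that the translation vectors
    \<open>w a\<close> describe T composed with \<open>\<phi> a\<close> itself.\<close>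
  have "\<exists>w\<in>V. \<forall>x\<in>V. T (\<phi> a x) = T (x + w)" if a: "a \<in> carrier A" for a
  proof -
    obtain w where w: "w \<in> V" "act_fun (inv a) T = translate n w T"
      using orb[OF inv_closed[OF a]] by blast
    have "T (\<phi> a x) = T (x + w)" if "x \<in> V" for x
      using fun_cong[OF w(2), of x] that a by simp
    then show ?thesis using w(1) by blast
  qed
  then obtain w where w: "\<And>a. a \<in> carrier A \<Longrightarrow> w a \<in> V"
    and Tw: "\<And>a x. a \<in> carrier A \<Longrightarrow> x \<in> V \<Longrightarrow> T (\<phi> a x) = T (x + w a)"
    by metis
  have stabI: "y + z \<in> stab n T" if "y \<in> V" "z \<in> V" "\<And>x. x \<in> V \<Longrightarrow> T (x + y) = T (x + z)" for y z
  proof -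
    have "translate n y T = translate n z T"
      using that by (intro funs_eqI[of _ n]) auto
    then show ?thesis using translate_eq_iff_stab[OF T] that by blast
  qed
  have stabD: "T (x + y) = T (x + z)" if "x \<in> V" "y \<in> V" "z \<in> V" "y + z \<in> stab n T" for x y z
    using fun_cong[of _ _ x, OF iffD2[OF translate_eq_iff_stab[OF T that(2,3)] that(4)]] that(1) by simp
  define s where "s = vec_sum n w (carrier A)"
  have s: "s \<in> V" by (simp add: s_def)
  have stab_s: "(\<phi> (inv b) s + w b) + s \<in> stab n T" if b: "b \<in> carrier A" for b
  proof -
    \<comment> \<open>The cocycle identity modulo the stabilizer, from computing T(a b x) in two
      ways.\<close>
    have "(\<phi> (inv b) (w a) + w b) + w (a \<otimes> b) \<in> stab n T" if a: "a \<in> carrier A" for a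
    proof (rule stabI)
      fix x assume x: "x \<in> V"
      have "T (x + (\<phi> (inv b) (w a) + w b)) = T ((x + \<phi> (inv b) (w a)) + w b)"
        using a b w x by (simp add: assoc_add_vec[of _ n])
      also have "\<dots> = T (\<phi> b (x + \<phi> (inv b) (w a)))"
        using a b w x by (simp add: Tw)
      also have "\<dots> = T (\<phi> a (\<phi> b x))"
        using a b w x by (simp add: act_add Tw)
      also have "\<dots> = T (x + w (a \<otimes> b))"
        using a b x by (simp add: Tw flip: act_mult)
      finally show "T (x + (\<phi> (inv b) (w a) + w b)) = T (x + w (a \<otimes> b))" .
    qed (use a b w in auto)
    then have "vec_sum n (\<lambda>a. (\<phi> (inv b) (w a) + w b) + w (a \<otimes> b)) (carrier A) \<in> stab n T"
      by (rule stab_vec_sum[OF T])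
    \<comment> \<open>Summing the identity over a with b fixed: the constant term \<open>w b\<close>
      survives because the order of A is odd, and the other two sums are
      \<open>\<phi> (inv b) s\<close> and s.\<close>
    also have "vec_sum n (\<lambda>a. (\<phi> (inv b) (w a) + w b) + w (a \<otimes> b)) (carrier A) =
        (vec_sum n (\<lambda>a. \<phi> (inv b) (w a)) (carrier A) + vec_sum n (\<lambda>_. w b) (carrier A))
          + vec_sum n (\<lambda>a. w (a \<otimes> b)) (carrier A)"
      using b w by (simp add: vec_sum_add)
    also have "vec_sum n (\<lambda>a. \<phi> (inv b) (w a)) (carrier A) = \<phi> (inv b) s"
      using b w by (simp add: s_def vec_sum_act finite_A)
    also have "vec_sum n (\<lambda>a. w (a \<otimes> b)) (carrier A) = s"
      unfolding s_def by (rule vec_sum_reindex[OF bij_mult_right[OF b]])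
    finally show ?thesis using b w by (simp add: vec_sum_const_odd odd_card_A)
  qed
  have "T (\<phi> b x + s) = T (x + s)" if b: "b \<in> carrier A" and x: "x \<in> V" for b x
  proof -
    have "T (\<phi> b x + s) = T (\<phi> b (x + \<phi> (inv b) s))"
      using b x s by (simp add: act_add)
    also have "\<dots> = T (x + (\<phi> (inv b) s + w b))"
      using b x s w by (simp add: Tw assoc_add_vec[of _ n])
    also have "\<dots> = T (x + s)"
      using b x s w stab_s[OF b] by (intro stabD) auto
    finally show ?thesis .
  qed
  then have "translate n s T \<in> inv_funs" by (simp add: inv_funs_def)
  then show ?thesis using s by blast
qed

text \<open>Invariance makes the Fourier coefficient at each \<open>act_fun a T\<close> nonzero, so
  A permutes the translates of T and \<open>exists_invariant_translate\<close> gives an invariant S.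
  The remaining point is that u vanishes on the stabilizer of S.\<close>

lemma semidirect_char_normal_form:
  assumes T: "T \<in> funs n" and u: "u \<in> V"
    and inv: "\<And>a g. a \<in> carrier A \<Longrightarrow> g \<in> carrier (semidirect n) \<Longrightarrow>
      semidirect_char n T u (semidirect_action A n \<phi> a g) = semidirect_char n T u g"
  shows "\<exists>S\<in>inv_funs. semidirect_char n T u = semidirect_char n S (0\<^sub>v n)"
proof -
  let ?\<chi> = "semidirect_char n T u"
  have inv': "?\<chi> (act_fun a f, \<phi> a t) = ?\<chi> (f, t)" if "a \<in> carrier A" "f \<in> funs n" "t \<in> V" for a f t
    using inv[of a "(f, t)"] that by (simp add: carrier_semidirect semidirect_action_apply)
  have "\<exists>v\<in>V. act_fun a T = translate n v T" if a: "a \<in> carrier A" for a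
  proof -
    have "(\<Sum>f\<in>funs n. ?\<chi> (f, 0\<^sub>v n) * bsgn (pairing n (act_fun a T) f)) =
        (\<Sum>f\<in>funs n. ?\<chi> (act_fun a f, 0\<^sub>v n) * bsgn (pairing n (act_fun a T) (act_fun a f)))"
      using sum_act_fun[OF a, of "\<lambda>f. ?\<chi> (f, 0\<^sub>v n) * bsgn (pairing n (act_fun a T) f)"] by simp
    also have "\<dots> = (\<Sum>f\<in>funs n. ?\<chi> (f, 0\<^sub>v n) * bsgn (pairing n T f))"
      using a inv'[OF a _ zero_carrier_vec] by (intro sum.cong refl) (simp add: pairing_act_fun)
    also have "\<dots> \<noteq> 0"
      unfolding semidirect_char_fourier[OF T T u] using T by (intro bexI[of _ "0\<^sub>v n"]) auto
    finally show ?thesis using semidirect_char_fourier[OF T act_fun_funs u] by blast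
  qed
  then obtain s where s: "s \<in> V" and S: "translate n s T \<in> inv_funs"
    using exists_invariant_translate[OF T] by blast
  define S where "S = translate n s T"
  have S: "S \<in> inv_funs" and \<chi>: "?\<chi> = semidirect_char n S u"
    using S semidirect_char_translate[OF T s] by (simp_all add: S_def)
  have "u \<bullet> t = 0" if t: "t \<in> stab n S" for t
  proof -
    \<comment> \<open>The character at (0, t) is the sign of \<open>u \<bullet> t\<close> times the
      nonzero number |V| / \<open>card (stab n S)\<close>, so its invariance passes to the
      sign.\<close>
    have "bsgn (u \<bullet> \<phi> a t) = (bsgn (u \<bullet> t) :: complex)" if a: "a \<in> carrier A" for a
    proof -
      have tV: "t \<in> V" using stab_carrier[OF t] .
      have z: "act_fun a (fun_zero n) = fun_zero n"
        using a by (intro funs_eqI[of _ n]) auto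
      have st: "\<phi> a t \<in> stab n S" using stab_act[OF S a tV] t by blast
      have "card V \<noteq> 0" "card (stab n S) \<noteq> 0"
        using t by (auto simp: card_carrier_vec_bit)
      then show ?thesis
        using inv'[OF a fun_zero_funs tV] a tV t st by (simp add: z \<chi> semidirect_char_apply)
    qed
    then have "u \<bullet> \<phi> a t = u \<bullet> t" if "a \<in> carrier A" for a
      using that by (fastforce simp: bsgn_def split: if_splits)
    \<comment> \<open>Pairing u with the sum of all \<open>\<phi> a t\<close> gives
      \<open>u \<bullet> t\<close> by oddness of the order of A, and 0 by
      \<open>norm_eq_zero\<close>.\<close>
    then have "(\<Sum>a\<in>carrier A. u \<bullet> \<phi> a t) = of_nat (card (carrier A)) * (u \<bullet> t)"
      by (simp only: sum_constant cong: sum.cong)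
    also have "\<dots> = u \<bullet> t"
      using of_nat_bit_odd[OF odd_card_A] by (simp only: mult_1_left)
    also have "(\<Sum>a\<in>carrier A. u \<bullet> \<phi> a t) = u \<bullet> vec_sum n (\<lambda>a. \<phi> a t) (carrier A)"
      using u stab_carrier[OF t] by (intro scalar_prod_vec_sum[symmetric] finite_A) auto
    finally show ?thesis using u stab_carrier[OF t] by (simp add: norm_eq_zero)
  qed
  \<comment> \<open>The character depends on u only through the values of
    \<open>u \<bullet> t\<close> for t in the stabilizer.\<close>
  then have "semidirect_char n S u = semidirect_char n S (0\<^sub>v n)"
    using u by (intro extensionalityI[of _ "carrier (semidirect n)"])
      (auto simp: semidirect_char_def stab_carrier)
  then show ?thesis using \<chi> S by auto
qed

section \<open>Both sides counted by the A-invariant functions\<close>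

lemma nonvanishing_Irr_eq:
  "nonvanishing_Irr A (semidirect_action A n \<phi>) (semidirect n) = (\<lambda>T. semidirect_char n T (0\<^sub>v n)) ` inv_funs"
proof (intro equalityI subsetI)
  fix \<chi> assume "\<chi> \<in> nonvanishing_Irr A (semidirect_action A n \<phi>) (semidirect n)"
  then obtain T u where "\<chi> = semidirect_char n T u" "T \<in> funs n" "u \<in> V"
    and "\<And>a g. a \<in> carrier A \<Longrightarrow> g \<in> carrier (semidirect n) \<Longrightarrow> \<chi> (semidirect_action A n \<phi> a g) = \<chi> g"
    by (auto simp: nonvanishing_Irr_def invariant_Irr_def Irr_semidirect)
  then show "\<chi> \<in> (\<lambda>T. semidirect_char n T (0\<^sub>v n)) ` inv_funs"
    using semidirect_char_normal_form[of T u] by blast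
next
  fix \<chi> assume "\<chi> \<in> (\<lambda>T. semidirect_char n T (0\<^sub>v n)) ` inv_funs"
  then obtain T where T: "T \<in> inv_funs" "\<chi> = semidirect_char n T (0\<^sub>v n)" by blast
  then have "\<chi> \<in> Irr (semidirect n)"
    using inv_funsD(1)[OF T(1)] zero_carrier_vec unfolding Irr_semidirect by blast
  moreover have "\<chi> (semidirect_action A n \<phi> a g) = \<chi> g"
    if "a \<in> carrier A" "g \<in> carrier (semidirect n)" for a g
    using that semidirect_char_invariant[OF T(1) that(1)]
    by (auto simp: T(2) carrier_semidirect semidirect_action_apply)
  moreover have "\<chi> c \<noteq> 0" if "c \<in> inv_funs \<times> {0\<^sub>v n}" for c
    using that semidirect_char_nonzero[OF T(1)] by (auto simp: T(2))
  ultimately show "\<chi> \<in> nonvanishing_Irr A (semidirect_action A n \<phi>) (semidirect n)"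
    by (simp add: nonvanishing_Irr_def invariant_Irr_def fixed_points_semidirect)
qed

text \<open>Elements fixed by A have trivial V-component, so they multiply by pointwise addition of
  functions. The fixed subgroup is therefore abelian, and its quotient by the trivial derived
  subgroup has its own order.\<close>

lemma order_abelianization_fixed_subgroup:
  "Coset.order (abelianization (fixed_subgroup A (semidirect_action A n \<phi>) (semidirect n))) = card inv_funs"
proof -
  define C where "C = fixed_subgroup A (semidirect_action A n \<phi>) (semidirect n)"
  have C: "C = (semidirect n)\<lparr>carrier := inv_funs \<times> {0\<^sub>v n}\<rparr>"
    by (simp add: C_def fixed_subgroup_def fixed_points_semidirect)
  interpret G: group "semidirect n" by (rule group_semidirect)
  have zero: "fun_zero n \<in> inv_funs" by (simp add: inv_funs_def)
  have add: "fun_add n f g \<in> inv_funs" if "f \<in> inv_funs" "g \<in> inv_funs" for f g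
    using that by (simp add: inv_funs_def)
  have "subgroup (inv_funs \<times> {0\<^sub>v n}) (semidirect n)"
    using zero
    by (intro G.subgroupI)
      (auto simp: carrier_semidirect inv_semidirect mult_semidirect inv_funsD add)
  then interpret C: group C unfolding C by (rule G.subgroup_imp_group)
  interpret C: comm_group C
  proof (rule C.group_comm_groupI)
    fix x y assume "x \<in> carrier C" "y \<in> carrier C"
    then obtain f g where fg: "x = (f, 0\<^sub>v n)" "y = (g, 0\<^sub>v n)" "f \<in> inv_funs" "g \<in> inv_funs"
      by (auto simp: C)
    have "fun_add n f g = fun_add n g f"
      by (rule funs_eqI[of _ n]) (simp_all only: fun_add_funs fun_add_apply add.commute)
    then show "x \<otimes>\<^bsub>C\<^esub> y = y \<otimes>\<^bsub>C\<^esub> x"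
      using fg by (simp add: C mult_semidirect inv_funsD)
  qed
  have "derived C (carrier C) = {\<one>\<^bsub>C\<^esub>}"
    by (rule C.derived_eq_singleton) simp
  then have "Coset.order (abelianization C) = card (rcosets\<^bsub>C\<^esub> {\<one>\<^bsub>C\<^esub>})"
    by (simp add: abelianization_def FactGroup_def Coset.order_def)
  also have "\<dots> = Coset.order C"
    using C.lagrange[OF C.triv_subgroup] by simp
  also have "\<dots> = card inv_funs"
    by (simp add: Coset.order_def C card_cartesian_product)
  finally show ?thesis by (simp add: C_def)
qed

end

theorem proposition3p2:
  fixes A :: "('a, 'c) monoid_scheme"
    and p n :: nat
    and \<phi> :: "'a \<Rightarrow> bit vec \<Rightarrow> bit vec"
  assumes "prime p" and "odd p"
    and "group A" and "finite (carrier A)" and "\<exists>k. Coset.order A = p ^ k"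
    and "linear_action A n \<phi>"
    and "fixed_points A \<phi> (carrier_vec n) = {0\<^sub>v n}"
  shows "\<not> balanced A n \<phi> \<and>
    card (nonvanishing_Irr A (semidirect_action A n \<phi>) (semidirect n)) =
      Coset.order (abelianization (fixed_subgroup A (semidirect_action A n \<phi>) (semidirect n)))"
proof -
  interpret fixed_point_free_action A p n \<phi>
    using assms by (simp add: fixed_point_free_action_def fixed_point_free_action_axioms_def)
  show ?thesis
    using not_balanced
    by (simp add: nonvanishing_Irr_eq card_image inj_on_semidirect_char order_abelianization_fixed_subgroup)
qed

end
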